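(* Let $\mathbb{X},\mathbb{Y}^1,\mathbb{Y}^2$ be standard Borel spaces, $\zeta\in\mathcal{P}(\mathbb{X})$, let $\mu$ be an information structure on $\mathbb{X}\times\mathbb{Y}^1\times\mathbb{Y}^2$ with $\mathbb{X}$-marginal $\zeta$, and let $G=(c,\mathbb{U}^1,\mathbb{U}^2)$ be a zero-sum game. Assume that $\mu$ is absolutely continuous with respect to a product measure: there exist probability measures $\bar Q^1$ on $\mathbb{Y}^1$ and $\bar Q^2$ on $\mathbb{Y}^2$ and an integrable function $f$ with $$\mu(A\times B\times C)=\int_{A\times B\times C} f(x,y^1,y^2)\,\zeta(dx)\bar Q^1(dy^1)\bar Q^2(dy^2)$$ for all Borel $A\subset\mathbb{X}$, $B\subset\mathbb{Y}^1$, $C\subset\mathbb{Y}^2$. Assume further: (i) the action spaces $\mathbb{U}^1,\mathbb{U}^2$ are compact; (ii) the cost function $c$ is bounded and, for every $x\in\mathbb{X}$, continuous in the players' actions $(u^1,u^2)$. Then an equilibrium exists under possibly randomized policies, and so the zero-sum game has a value.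
   Context: A standard Borel space is a Borel subset of a complete separable metric space; $\mathcal{P}(\cdot)$ denotes Borel probability measures. The state $x$ has law $\zeta$; player $i\in\{1,2\}$ observes only $y^i\in\mathbb{Y}^i$. Player 1 minimizes and player 2 maximizes the expected cost. An information structure is a joint probability measure $\mu(dx,dy^1,dy^2)$ on $\mathbb{X}\times\mathbb{Y}^1\times\mathbb{Y}^2$ with marginal $\zeta$ on $\mathbb{X}$. A game is a triple $G=(c,\mathbb{U}^1,\mathbb{U}^2)$ with standard Borel action spaces $\mathbb{U}^1,\mathbb{U}^2$ and a measurable bounded cost $c:\mathbb{X}\times\mathbb{U}^1\times\mathbb{U}^2\to\mathbb{R}$. $\Gamma^i$ is the set of randomized policies of player $i$: $u^i=\gamma^i(y^i,\omega^i)$ with $\gamma^i$ measurable and $\omega^i$ independent noise; equivalently stochastic kernels $\gamma^i(du^i|y^i)$ from $\mathbb{Y}^i$ to $\mathbb{U}^i$. The expected cost is $$V_G^\mu(\gamma^1,\gamma^2)=\int c(x,u^1,u^2)\,\gamma^1(du^1|y^1)\gamma^2(du^2|y^2)\,\mu(dx,dy^1,dy^2).$$ An equilibrium is a pair $(\gamma^{1,*},\gamma^{2,*})\in\Gamma^1\times\Gamma^2$ with $\inf_{\gamma^1\in\Gamma^1}V_G^\mu(\gamma^1,\gamma^{2,*})=V_G^\mu(\gamma^{1,*},\gamma^{2,*})=\sup_{\gamma^2\in\Gamma^2}V_G^\mu(\gamma^{1,*},\gamma^2)$. The game has a value if $\inf_{\gamma^1\in\Gamma^1}\sup_{\gamma^2\in\Gamma^2}V_G^\mu(\gamma^1,\gamma^2)=\sup_{\gamma^2\in\Gamma^2}\inf_{\gamma^1\in\Gamma^1}V_G^\mu(\gamma^1,\gamma^2)$.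 *)

theory Defs
  imports "HOL-Probability.Probability"
begin

text \<open>
  A standard Borel space is a Borel subset \<^term>\<open>S\<close> of a Polish space, the latter being a type of
  class \<^class>\<open>polish_space\<close>. Its Borel sigma-algebra is the trace on \<^term>\<open>S\<close>.
\<close>

definition standard_borel_set :: "'a::polish_space set \<Rightarrow> bool" where
  "standard_borel_set S \<longleftrightarrow> S \<in> sets borel"

definition borel_sub :: "'a::polish_space set \<Rightarrow> 'a measure" where
  "borel_sub S = restrict_space borel S"

text \<open>All spaces are second countable, so the product sigma-algebra is the Borel one.\<close>

definition info_space ::
  "'x::polish_space set \<Rightarrow> 'y1::polish_space set \<Rightarrow> 'y2::polish_space set \<Rightarrow> ('x \<times> 'y1 \<times> 'y2) measure"
where
  "info_space X Y1 Y2 = borel_sub X \<Otimes>\<^sub>M (borel_sub Y1 \<Otimes>\<^sub>M borel_sub Y2)"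

definition information_structure ::
  "'x::polish_space set \<Rightarrow> 'y1::polish_space set \<Rightarrow> 'y2::polish_space set \<Rightarrow> 'x measure
    \<Rightarrow> ('x \<times> 'y1 \<times> 'y2) measure \<Rightarrow> bool"
where
  "information_structure X Y1 Y2 \<zeta> \<mu> \<longleftrightarrow>
     \<mu> \<in> space (prob_algebra (info_space X Y1 Y2)) \<and> distr \<mu> (borel_sub X) fst = \<zeta>"

text \<open>
  The action spaces are required to be nonempty: otherwise a player has no policy at all.
\<close>

definition zero_sum_game ::
  "'x::polish_space set \<Rightarrow> ('x \<times> 'u1::polish_space \<times> 'u2::polish_space \<Rightarrow> real)
    \<Rightarrow> 'u1 set \<Rightarrow> 'u2 set \<Rightarrow> bool"
where
  "zero_sum_game X c U1 U2 \<longleftrightarrow>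
     standard_borel_set U1 \<and> U1 \<noteq> {} \<and> standard_borel_set U2 \<and> U2 \<noteq> {} \<and>
     c \<in> borel_measurable (borel_sub X \<Otimes>\<^sub>M (borel_sub U1 \<Otimes>\<^sub>M borel_sub U2)) \<and>
     bounded (c ` (X \<times> U1 \<times> U2))"

text \<open>Randomized policies are stochastic kernels from \<^term>\<open>Y\<close> to \<^term>\<open>U\<close>.\<close>

definition policies ::
  "'y::polish_space set \<Rightarrow> 'u::polish_space set \<Rightarrow> ('y \<Rightarrow> 'u measure) set"
where
  "policies Y U = borel_sub Y \<rightarrow>\<^sub>M prob_algebra (borel_sub U)"

definition expected_cost ::
  "('x \<times> 'y1 \<times> 'y2) measure \<Rightarrow> ('x \<times> 'u1 \<times> 'u2 \<Rightarrow> real)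
    \<Rightarrow> ('y1 \<Rightarrow> 'u1 measure) \<Rightarrow> ('y2 \<Rightarrow> 'u2 measure) \<Rightarrow> real"
where
  "expected_cost \<mu> c \<gamma>1 \<gamma>2 =
     (\<integral>(x, y1, y2). (\<integral>(u1, u2). c (x, u1, u2) \<partial>(\<gamma>1 y1 \<Otimes>\<^sub>M \<gamma>2 y2)) \<partial>\<mu>)"

text \<open>
  The real-valued infima and suprema below are the genuine ones for every
  \<^const>\<open>zero_sum_game\<close>: there the policy sets are nonempty and the expected cost is bounded.
\<close>

definition equilibrium ::
  "'y1::polish_space set \<Rightarrow> 'y2::polish_space set \<Rightarrow> ('x \<times> 'y1 \<times> 'y2) measure
    \<Rightarrow> ('x \<times> 'u1::polish_space \<times> 'u2::polish_space \<Rightarrow> real) \<Rightarrow> 'u1 set \<Rightarrow> 'u2 set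
    \<Rightarrow> ('y1 \<Rightarrow> 'u1 measure) \<Rightarrow> ('y2 \<Rightarrow> 'u2 measure) \<Rightarrow> bool"
where
  "equilibrium Y1 Y2 \<mu> c U1 U2 \<gamma>1 \<gamma>2 \<longleftrightarrow>
     \<gamma>1 \<in> policies Y1 U1 \<and> \<gamma>2 \<in> policies Y2 U2 \<and>
     (INF \<gamma>\<in>policies Y1 U1. expected_cost \<mu> c \<gamma> \<gamma>2) = expected_cost \<mu> c \<gamma>1 \<gamma>2 \<and>
     expected_cost \<mu> c \<gamma>1 \<gamma>2 = (SUP \<gamma>\<in>policies Y2 U2. expected_cost \<mu> c \<gamma>1 \<gamma>)"

definition has_value ::
  "'y1::polish_space set \<Rightarrow> 'y2::polish_space set \<Rightarrow> ('x \<times> 'y1 \<times> 'y2) measure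
    \<Rightarrow> ('x \<times> 'u1::polish_space \<times> 'u2::polish_space \<Rightarrow> real) \<Rightarrow> 'u1 set \<Rightarrow> 'u2 set \<Rightarrow> bool"
where
  "has_value Y1 Y2 \<mu> c U1 U2 \<longleftrightarrow>
     (INF \<gamma>1\<in>policies Y1 U1. SUP \<gamma>2\<in>policies Y2 U2. expected_cost \<mu> c \<gamma>1 \<gamma>2) =
     (SUP \<gamma>2\<in>policies Y2 U2. INF \<gamma>1\<in>policies Y1 U1. expected_cost \<mu> c \<gamma>1 \<gamma>2)"

end

theory Submission
  imports Defs
begin

text \<open>
  The expected cost is affine in each player's policy, so it suffices to give each player an optimal
  policy; the second player's case follows by exchanging the players and negating the cost.
  For finitely many opponent policies, near-optimal policies exist by the finite minimax theorem.
  To pass to all opponent policies at once, represent a policy by its conditional moments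
  \<open>(y, k) \<mapsto> \<integral> s\<^sup>k d\<gamma>(y)\<close>, where \<open>s\<close> is an injective Borel coding of the compact action space into
  \<open>[0, 1]\<close> with uniformly continuous inverse. In the \<open>L\<^sup>2\<close> space of these moments,
  near-minimisers of the norm in a downward directed family of convex sets form a Cauchy sequence by
  the parallelogram law. Along it the moments converge almost surely, hence the policies converge
  weakly for almost every observation, and by dominated convergence so does the expected cost
  against every policy of the opponent. This replaces the compactness of the space of Young measures.
\<close>

section \<open>Minimax by norm minimisation\<close>

text \<open>The constraints are indexed by all opponent policies and all slacks, an uncountable
  family, whereas almost sure and dominated convergence handle only sequences. Extracting a
  convergent subsequence separately for each constraint would give limits that differ from one
  constraint to the next. Minimal norms remove that choice: their supremum over the family is
  approached along a countable decreasing chain, and all near-minimisers taken in that chain share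
  one limit. A second sequence may therefore be taken inside any prescribed constraint set and must
  have the limit of the first, so that a single policy meets every constraint. Moments serve as
  coordinates because they depend affinely on the policy, as the parallelogram law requires, and are
  countable in number. The code \<open>s\<close> is Borel but in general discontinuous; its moments
  determine weak limits because decoding is continuous on the closure of the image of
  \<open>U\<close> under \<open>s\<close>.\<close>

lemma finite_minimax:
  fixes f :: "'a \<Rightarrow> 'j \<Rightarrow> real"
  assumes J: "finite J" and ne: "A \<noteq> {}" and eps: "\<epsilon> > 0"
    and bdd: "\<And>x j. x \<in> A \<Longrightarrow> j \<in> J \<Longrightarrow> \<bar>f x j\<bar> \<le> M"
    and mix: "\<And>x x' t. x \<in> A \<Longrightarrow> x' \<in> A \<Longrightarrow> 0 \<le> t \<Longrightarrow> t \<le> 1 \<Longrightarrow>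
      \<exists>y\<in>A. \<forall>j\<in>J. f y j = (1 - t) * f x j + t * f x' j"
    and dual: "\<And>p. (\<And>j. j \<in> J \<Longrightarrow> 0 \<le> p j) \<Longrightarrow> sum p J = 1 \<Longrightarrow> \<exists>x\<in>A. (\<Sum>j\<in>J. p j * f x j) \<le> w"
  shows "\<exists>x\<in>A. \<forall>j\<in>J. f x j \<le> w + \<epsilon>"
proof -
  \<comment> \<open>Squared positive parts penalise violations of \<open>f x j \<le> w\<close> and
    are differentiable, so along a segment in \<open>A\<close> the penalty changes by a first-order
    gain and an error of order \<open>t\<^sup>2\<close>. The goal is that its infimum is at most
    0.\<close>
  define a where "a x j = max 0 (f x j - w)" for x j
  define \<Phi> where "\<Phi> x = (\<Sum>j\<in>J. (a x j)\<^sup>2)" for x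
  define d where "d = (INF x\<in>A. \<Phi> x)"
  define K where "K = card J * (2 * M)\<^sup>2"
  have \<Phi>0: "0 \<le> \<Phi> x" for x unfolding \<Phi>_def by (intro sum_nonneg) auto
  have bb: "bdd_below (\<Phi> ` A)" using \<Phi>0 by (intro bdd_belowI[of _ 0]) auto
  have d_le: "d \<le> \<Phi> x" if "x \<in> A" for x unfolding d_def by (rule cINF_lower[OF bb that])
  have near: "\<exists>x\<in>A. \<Phi> x < r" if "d < r" for r
    using that cINF_less_iff[OF ne bb, of r] unfolding d_def by simp
  \<comment> \<open>At a near-minimiser \<open>x\<close> of \<open>\<Phi>\<close> with \<open>\<Phi> x > 0\<close>, moving towards a good reply to the weights
    \<open>a x\<close> would decrease \<open>\<Phi>\<close> to first order.\<close>
  have step: "d \<le> (1 - 2 * t) * \<Phi> x + K * t\<^sup>2" if x: "x \<in> A" and t: "0 \<le> t" "t \<le> 1" and pos: "0 < \<Phi> x" for x t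
  proof -
    define S where "S = (\<Sum>j\<in>J. a x j)"
    have a0: "0 \<le> a x j" for j by (simp add: a_def)
    have "S \<noteq> 0"
    proof
      assume "S = 0"
      then have "\<forall>j\<in>J. a x j = 0" unfolding S_def using J a0 by (subst (asm) sum_nonneg_eq_0_iff) auto
      then show False using pos unfolding \<Phi>_def by simp
    qed
    moreover have "0 \<le> S" unfolding S_def by (intro sum_nonneg a0)
    ultimately have S: "S > 0" by simp
    obtain x' where x': "x' \<in> A" "(\<Sum>j\<in>J. a x j / S * f x' j) \<le> w"
      using dual[of "\<lambda>j. a x j / S"] S a0 by (auto simp: sum_divide_distrib[symmetric] S_def)
    have "(\<Sum>j\<in>J. a x j / S * f x' j) = (\<Sum>j\<in>J. a x j * f x' j) / S"
      by (simp add: sum_divide_distrib)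
    with x'(2) have "(\<Sum>j\<in>J. a x j * f x' j) / S \<le> w" by simp
    with S have "(\<Sum>j\<in>J. a x j * f x' j) \<le> w * S" by (simp add: pos_divide_le_eq)
    then have *: "(\<Sum>j\<in>J. a x j * (f x' j - w)) \<le> 0"
      by (simp add: algebra_simps sum_subtractf S_def sum_distrib_left)
    define b where "b j = f x' j - f x j" for j
    have ax: "a x j * (f x j - w) = (a x j)\<^sup>2" for j
      by (auto simp: a_def max_def power2_eq_square)
    have "(\<Sum>j\<in>J. a x j * (f x' j - w)) = (\<Sum>j\<in>J. a x j * b j) + \<Phi> x"
      unfolding \<Phi>_def sum.distrib[symmetric] ax[symmetric] b_def by (simp add: algebra_simps)
    with * have ab: "(\<Sum>j\<in>J. a x j * b j) \<le> - \<Phi> x" by simp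
    have b2: "(b j)\<^sup>2 \<le> (2 * M)\<^sup>2" if "j \<in> J" for j
      using bdd[OF x that] bdd[OF x'(1) that] unfolding b_def by (intro abs_le_square_iff[THEN iffD1]) auto
    obtain y where y: "y \<in> A" "\<forall>j\<in>J. f y j = (1 - t) * f x j + t * f x' j"
      using mix[OF x x'(1) t] by auto
    \<comment> \<open>Bounding \<open>f x j - w\<close> by \<open>a x j\<close> before moving avoids
      following the sign of the constraint along the segment; where \<open>f y j < w\<close> the
      left side is 0.\<close>
    have ay: "(a y j)\<^sup>2 \<le> (a x j + t * b j)\<^sup>2" if "j \<in> J" for j
    proof -
      have "f y j - w \<le> a x j + t * b j" using y(2) that unfolding a_def b_def by (auto simp: algebra_simps)
      then show ?thesis
        unfolding a_def[of y] by (cases "0 \<le> f y j - w") (auto intro!: power_mono simp: max_def)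
    qed
    have "d \<le> \<Phi> y" by (rule d_le[OF y(1)])
    also have "\<dots> \<le> (\<Sum>j\<in>J. (a x j + t * b j)\<^sup>2)" unfolding \<Phi>_def by (intro sum_mono ay)
    also have "\<dots> = \<Phi> x + 2 * t * (\<Sum>j\<in>J. a x j * b j) + t\<^sup>2 * (\<Sum>j\<in>J. (b j)\<^sup>2)"
      by (simp add: \<Phi>_def power2_sum sum.distrib sum_distrib_left power_mult_distrib algebra_simps)
    also have "\<dots> \<le> \<Phi> x + 2 * t * (- \<Phi> x) + t\<^sup>2 * K"
      using ab t sum_bounded_above[of J "\<lambda>j. (b j)\<^sup>2", OF b2] unfolding K_def
      by (intro add_mono mult_left_mono order_refl) auto
    finally show ?thesis by (simp add: algebra_simps)
  qed
  have "d \<le> 0"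
  proof (rule ccontr)
    assume "\<not> d \<le> 0"
    then have d: "d > 0" by simp
    have K: "K \<ge> 0" unfolding K_def by simp
    \<comment> \<open>The first-order gain is \<open>2 * t * d\<close>. The near-minimality gap
      \<open>t\<^sup>2\<close> and the curvature term \<open>K * t\<^sup>2\<close> together cost
      \<open>t * (t * (1 + K))\<close>, which this choice keeps at most \<open>t * d\<close>. The
      cap \<open>1/2\<close> keeps \<open>1 - 2 * t\<close> nonnegative.\<close>
    define t where "t = min (1/2) (d / (1 + K))"
    have t: "0 < t" "t \<le> 1/2" "t * (1 + K) \<le> d"
    proof -
      show "0 < t" "t \<le> 1/2" unfolding t_def using d K by (simp, intro min.cobounded1)
      have "t * (1 + K) \<le> d / (1 + K) * (1 + K)" using K by (intro mult_right_mono) (auto simp: t_def)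
      then show "t * (1 + K) \<le> d" using K by simp
    qed
    obtain x where x: "x \<in> A" "\<Phi> x < d + t\<^sup>2" using near[of "d + t\<^sup>2"] t by auto
    have "d \<le> (1 - 2 * t) * \<Phi> x + K * t\<^sup>2"
      using step[of x t] x t d d_le[OF x(1)] by auto
    also have "\<dots> \<le> (1 - 2 * t) * (d + t\<^sup>2) + K * t\<^sup>2"
      using x t by (intro add_right_mono mult_left_mono) auto
    also have "\<dots> \<le> d - 2 * t * d + t * (t * (1 + K))"
      using t by (simp add: algebra_simps power2_eq_square)
    also have "\<dots> \<le> d - 2 * t * d + t * d"
      using t by (intro add_left_mono mult_left_mono) auto
    finally have "t * d \<le> 0" by (simp add: mult.commute)
    then show False using t d by (simp add: mult_le_0_iff)
  qed
  then have "d < \<epsilon>\<^sup>2" using eps by (simp add: le_less_trans)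
  then obtain x where x: "x \<in> A" "\<Phi> x < \<epsilon>\<^sup>2" using near by blast
  have "f x j \<le> w + \<epsilon>" if "j \<in> J" for j
  proof -
    have "(a x j)\<^sup>2 \<le> \<Phi> x" unfolding \<Phi>_def using J that by (intro member_le_sum) auto
    then have "(a x j)\<^sup>2 < \<epsilon>\<^sup>2" using x by simp
    then have "a x j < \<epsilon>" using eps by (simp add: power2_less_imp_less)
    then show ?thesis by (simp add: a_def)
  qed
  then show ?thesis using x by auto
qed

text \<open>Two-point mixing is iterated: the inserted point keeps its weight and the others are
  renormalised. One \<open>b\<close> must work for all \<open>a\<close> at once, since it becomes
  the single opponent policy that stands for a finite mixture.\<close>

lemma finite_mixture:
  fixes V :: "'a \<Rightarrow> 'b \<Rightarrow> real"
  assumes mix: "\<And>b b' t. b \<in> B \<Longrightarrow> b' \<in> B \<Longrightarrow> 0 \<le> t \<Longrightarrow> t \<le> 1 \<Longrightarrow>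
      \<exists>y\<in>B. \<forall>a\<in>A. V a y = (1 - t) * V a b + t * V a b'"
    and "finite S" "S \<subseteq> B" "\<And>s. s \<in> S \<Longrightarrow> 0 \<le> p s" "sum p S = 1"
  shows "\<exists>b\<in>B. \<forall>a\<in>A. V a b = (\<Sum>s\<in>S. p s * V a s)"
  using assms(2-)
proof (induction S arbitrary: p rule: finite_induct)
  case empty
  then show ?case by simp
next
  case (insert x S)
  have s: "sum p S = 1 - p x" using insert by simp
  show ?case
  proof (cases "p x = 1")
    case True
    then have "\<forall>s\<in>S. p s = 0" using s insert sum_nonneg_eq_0_iff[of S p] by auto
    then show ?thesis using True insert by (intro bexI[of _ x]) auto
  next
    case False
    moreover have "0 \<le> sum p S" using insert by (intro sum_nonneg) auto
    ultimately have px: "p x < 1" "0 \<le> p x" using s insert by auto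
    obtain b where b: "b \<in> B" "\<forall>a\<in>A. V a b = (\<Sum>s\<in>S. p s / (1 - p x) * V a s)"
      using insert.IH[of "\<lambda>s. p s / (1 - p x)"] insert.prems px s
      by (auto simp: sum_divide_distrib[symmetric])
    obtain y where y: "y \<in> B" "\<forall>a\<in>A. V a y = (1 - p x) * V a b + p x * V a x"
      using mix[of b x "p x"] b insert.prems px by auto
    have "V a y = (\<Sum>s\<in>insert x S. p s * V a s)" if "a \<in> A" for a
      using y b that px insert by (simp add: sum_distrib_left)
    then show ?thesis using y by auto
  qed
qed

section \<open>Almost sure convergence of near-minimisers of the norm\<close>

lemma (in prob_space) AE_convergent_if_L2_fast_Cauchy:
  fixes g :: "nat \<Rightarrow> 'a \<Rightarrow> real"
  assumes [measurable]: "\<And>n. g n \<in> borel_measurable M"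
    and int: "\<And>n. integrable M (\<lambda>z. (g (Suc n) z - g n z)\<^sup>2)"
    and fast: "\<And>n. (\<integral>z. (g (Suc n) z - g n z)\<^sup>2 \<partial>M) \<le> C * (1/4) ^ n"
  shows "AE z in M. convergent (\<lambda>n. g n z)"
proof -
  define D where "D n z = \<bar>g (Suc n) z - g n z\<bar>" for n z
  have [measurable]: "D n \<in> borel_measurable M" for n unfolding D_def by measurable
  \<comment> \<open>A weighted arithmetic-geometric mean inequality: the weight \<open>2 ^ n\<close>
    against the decay \<open>(1/4) ^ n\<close> of the squares leaves a summable
    \<open>(1/2) ^ n\<close> in both terms.\<close>
  have amgm: "\<bar>r\<bar> \<le> 2 ^ n * r\<^sup>2 + (1/2) ^ n" for r :: real and n
  proof -
    have "0 \<le> (2 ^ n * \<bar>r\<bar> - 1)\<^sup>2" by simp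
    then have "2 * (2 ^ n * \<bar>r\<bar>) \<le> (2 ^ n)\<^sup>2 * r\<^sup>2 + 1"
      by (simp add: power2_diff power_mult_distrib)
    then have "2 ^ n * \<bar>r\<bar> \<le> (2 ^ n)\<^sup>2 * r\<^sup>2 + 1"
      by (smt (verit) mult_nonneg_nonneg abs_ge_zero zero_le_power)
    also have "\<dots> = 2 ^ n * (2 ^ n * r\<^sup>2 + (1/2) ^ n)"
      by (simp add: algebra_simps power2_eq_square flip: power_mult_distrib)
    finally show ?thesis by simp
  qed
  have Dint: "integrable M (D n)" for n
  proof (rule Bochner_Integration.integrable_bound)
    show "integrable M (\<lambda>z. 2 ^ n * (g (Suc n) z - g n z)\<^sup>2 + (1/2) ^ n)" using int by simp
    show "AE x in M. norm (D n x) \<le> norm (2 ^ n * (g (Suc n) x - g n x)\<^sup>2 + (1 / 2) ^ n)"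
      using amgm unfolding D_def by (intro AE_I2) (auto intro: order_trans[OF _ abs_ge_self])
  qed simp
  have Dle: "(\<integral>z. D n z \<partial>M) \<le> (C + 1) * (1/2) ^ n" for n
  proof -
    have "(\<integral>z. D n z \<partial>M) \<le> (\<integral>z. 2 ^ n * (g (Suc n) z - g n z)\<^sup>2 + (1/2) ^ n \<partial>M)"
      using int Dint[of n] amgm by (intro integral_mono) (auto simp: D_def[abs_def])
    also have "\<dots> = 2 ^ n * (\<integral>z. (g (Suc n) z - g n z)\<^sup>2 \<partial>M) + (1/2) ^ n"
      using int by (simp add: prob_space)
    also have "\<dots> \<le> 2 ^ n * (C * (1/4) ^ n) + (1/2) ^ n"
      using fast[of n] by (intro add_right_mono mult_left_mono) auto
    also have "\<dots> = (C + 1) * (1/2) ^ n"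
      by (simp add: algebra_simps flip: power_mult_distrib)
    finally show ?thesis .
  qed
  have D0: "D n z \<ge> 0" for n z by (simp add: D_def)
  \<comment> \<open>The summed absolute increments have finite integral, hence are finite almost
    everywhere; the telescoping series then converges along the full sequence, without passing to a
    subsequence.\<close>
  have "(\<integral>\<^sup>+z. (\<Sum>n. ennreal (D n z)) \<partial>M) = (\<Sum>n. ennreal (\<integral>z. D n z \<partial>M))"
    using Dint D0 by (subst nn_integral_suminf) (auto intro!: suminf_cong nn_integral_eq_integral AE_I2)
  also have "\<dots> < \<infinity>"
  proof -
    have "summable (\<lambda>n. \<integral>z. D n z \<partial>M)"
    proof (rule summable_comparison_test')
      show "summable (\<lambda>n. (C + 1) * (1/2::real) ^ n)" by (intro summable_mult summable_geometric) auto
      show "norm (\<integral>z. D n z \<partial>M) \<le> (C + 1) * (1/2) ^ n" for n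
        using Dle[of n] D0 by (simp add: integral_nonneg_AE)
    qed
    then show ?thesis
      using D0 by (subst suminf_ennreal2) (auto simp: integral_nonneg_AE)
  qed
  finally have "AE z in M. (\<Sum>n. ennreal (D n z)) \<noteq> \<infinity>"
    by (intro nn_integral_PInf_AE) auto
  then show ?thesis
  proof eventually_elim
    case (elim z)
    then have "summable (\<lambda>n. D n z)" using D0 by (intro summable_suminf_not_top) auto
    then have "summable (\<lambda>n. g (Suc n) z - g n z)" unfolding D_def by (rule summable_rabs_cancel)
    then have "convergent (\<lambda>n. \<Sum>i<n. g (Suc i) z - g i z)" by (simp add: summable_iff_convergent)
    moreover have "(\<Sum>i<n. g (Suc i) z - g i z) = g n z - g 0 z" for n by (induction n) auto
    ultimately have "convergent (\<lambda>n. g n z - g 0 z)" by simp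
    then have "convergent (\<lambda>n. g n z - g 0 z + g 0 z)" by (intro convergent_add convergent_const)
    then show ?case by simp
  qed
qed

text \<open>
  The interleaving of \<open>x\<close> with \<open>x'\<close> records that both sequences have the same limit.
\<close>

lemma (in prob_space) min_norm_sequence:
  fixes e :: "'c \<Rightarrow> 'a \<Rightarrow> real"
  assumes meas: "\<And>c. c \<in> A \<Longrightarrow> e c \<in> borel_measurable M"
    and bnd: "\<And>c z. c \<in> A \<Longrightarrow> z \<in> space M \<Longrightarrow> \<bar>e c z\<bar> \<le> 1"
    and "\<C> \<noteq> {}" and sub: "\<And>C. C \<in> \<C> \<Longrightarrow> C \<subseteq> A" and ne: "\<And>C. C \<in> \<C> \<Longrightarrow> C \<noteq> {}"
    and Int: "\<And>C D. C \<in> \<C> \<Longrightarrow> D \<in> \<C> \<Longrightarrow> C \<inter> D \<in> \<C>"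
    and mid: "\<And>C a b. C \<in> \<C> \<Longrightarrow> a \<in> C \<Longrightarrow> b \<in> C \<Longrightarrow> \<exists>m\<in>C. \<forall>z\<in>space M. e m z = (e a z + e b z) / 2"
  shows "\<exists>x. range x \<subseteq> A \<and> (AE z in M. convergent (\<lambda>n. e (x n) z)) \<and>
    (\<forall>C\<in>\<C>. \<exists>x'. range x' \<subseteq> C \<and> (AE z in M. convergent (\<lambda>n. e (if even n then x n else x' n) z)))"
proof -
  have int2: "integrable M (\<lambda>z. h z)" if "h \<in> borel_measurable M" "\<And>z. z \<in> space M \<Longrightarrow> \<bar>h z\<bar> \<le> 4" for h :: "'a \<Rightarrow> real"
    using that by (intro integrable_const_bound[of _ 4]) auto
  define N where "N c = (\<integral>z. (e c z)\<^sup>2 \<partial>M)" for c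
  have sq1: "(e c z)\<^sup>2 \<le> 1" if "c \<in> A" "z \<in> space M" for c z
    using bnd[OF that] by (simp add: abs_square_le_1)
  have intN: "integrable M (\<lambda>z. (e c z)\<^sup>2)" if "c \<in> A" for c
    using meas[OF that] sq1[OF that] by (intro int2) (auto intro: order_trans[of _ 1])
  have N0: "0 \<le> N c" for c unfolding N_def by simp
  have N1: "N c \<le> 1" if "c \<in> A" for c
  proof -
    have "N c \<le> (\<integral>z. 1 \<partial>M)" unfolding N_def
      using intN[OF that] sq1[OF that] by (intro integral_mono) auto
    then show ?thesis by (simp add: prob_space)
  qed
  define \<nu> where "\<nu> C = (INF c\<in>C. N c)" for C
  have \<nu>_le: "\<nu> C \<le> N c" if "c \<in> C" for c C
    unfolding \<nu>_def using N0 that by (intro cINF_lower bdd_belowI[of _ 0]) auto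
  have \<nu>_near: "\<exists>c\<in>C. N c < r" if "C \<in> \<C>" "\<nu> C < r" for C r
  proof -
    have "bdd_below (N ` C)" using N0 by (intro bdd_belowI[of _ 0]) auto
    then show ?thesis using that cINF_less_iff[of C N r] ne unfolding \<nu>_def by auto
  qed
  have \<nu>1: "\<nu> C \<le> 1" if "C \<in> \<C>" for C
    using \<nu>_le[of _ C] N1 sub[OF that] ne[OF that] by (meson equals0I order_trans subsetD)
  have \<nu>_mono: "\<nu> D \<le> \<nu> C" if "C \<subseteq> D" "C \<in> \<C>" for C D
    unfolding \<nu>_def using that ne N0 by (intro cINF_superset_mono bdd_belowI[of _ 0]) auto
  \<comment> \<open>Smaller sets have larger minimal norm, so \<open>d\<close> is the limit of the
    minimal norms along the directed family. It is finite because all coordinates are bounded by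
    1.\<close>
  define d where "d = (SUP C\<in>\<C>. \<nu> C)"
  have bda: "bdd_above (\<nu> ` \<C>)" using \<nu>1 by (intro bdd_aboveI[of _ 1]) auto
  have \<nu>d: "\<nu> C \<le> d" if "C \<in> \<C>" for C unfolding d_def by (rule cSUP_upper[OF that bda])
  define \<delta> :: "nat \<Rightarrow> real" where "\<delta> n = (1/4) ^ n" for n
  have \<delta>: "\<delta> n > 0" for n by (simp add: \<delta>_def)
  have "\<exists>D\<in>\<C>. d - \<delta> n < \<nu> D" for n
    using less_cSUP_iff[OF \<open>\<C> \<noteq> {}\<close> bda, of "d - \<delta> n"] \<delta>[of n] unfolding d_def by simp
  then obtain D where D: "\<And>n. D n \<in> \<C>" "\<And>n. d - \<delta> n < \<nu> (D n)" by metis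
  \<comment> \<open>Intersecting makes the sets decrease while \<open>\<nu> (E n)\<close> stays
    above \<open>d - \<delta> n\<close>; consecutive terms of a selection then lie in a common set
    that contains their midpoint.\<close>
  define E where "E n = (\<Inter>i\<le>n. D i)" for n
  have E: "E n \<in> \<C>" for n
  proof (induction n)
    case (Suc n)
    have "E (Suc n) = E n \<inter> D (Suc n)" unfolding E_def by (auto simp: atMost_Suc)
    then show ?case using Int Suc D by simp
  qed (simp add: E_def D)
  have E_mono: "E m \<subseteq> E n" if "n \<le> m" for n m unfolding E_def using that by auto
  have \<nu>E: "d - \<delta> n < \<nu> (E n)" for n
    using D(2)[of n] \<nu>_mono[of "E n" "D n"] E[of n] by (force simp: E_def)
  \<comment> \<open>Stated for an arbitrary selection, since it is applied both to \<open>x\<close>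
    and to its interleavings with other sequences.\<close>
  have conv: "AE z in M. convergent (\<lambda>n. e (x n) z)" if x: "\<And>n. x n \<in> E n" "\<And>n. N (x n) < d + \<delta> n" for x
  proof (rule AE_convergent_if_L2_fast_Cauchy)
    have xA: "x n \<in> A" for n using x E sub by blast
    show [measurable]: "e (x n) \<in> borel_measurable M" for n by (rule meas[OF xA])
    have sq4: "\<bar>(e (x (Suc n)) z - e (x n) z)\<^sup>2\<bar> \<le> 4" if "z \<in> space M" for n z
    proof -
      have "\<bar>e (x (Suc n)) z - e (x n) z\<bar> \<le> 2" using bnd[OF xA that, of n] bnd[OF xA that, of "Suc n"] by linarith
      then have "(e (x (Suc n)) z - e (x n) z)\<^sup>2 \<le> 2\<^sup>2" by (intro abs_le_square_iff[THEN iffD1]) auto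
      then show ?thesis by simp
    qed
    show I: "integrable M (\<lambda>z. (e (x (Suc n)) z - e (x n) z)\<^sup>2)" for n
      using sq4 by (intro int2) auto
    \<comment> \<open>The midpoint lies in \<open>E n\<close>, so its squared norm exceeds
      \<open>d - \<delta> n\<close>, while both ends stay below \<open>d + \<delta> n\<close>. The
      parallelogram law leaves \<open>4 * (d + \<delta> n) - 4 * (d - \<delta> n)\<close>, hence the
      factor 8.\<close>
    show "(\<integral>z. (e (x (Suc n)) z - e (x n) z)\<^sup>2 \<partial>M) \<le> 8 * (1/4) ^ n" for n
    proof -
      have "x (Suc n) \<in> E n" using x(1)[of "Suc n"] E_mono[of n "Suc n"] by auto
      then obtain m where m: "m \<in> E n" "\<forall>z\<in>space M. e m z = (e (x n) z + e (x (Suc n)) z) / 2"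
        using mid[OF E x(1)] by blast
      have mA: "m \<in> A" using m E sub by blast
      have "(\<integral>z. (e (x (Suc n)) z - e (x n) z)\<^sup>2 \<partial>M)
        = (\<integral>z. 2 * (e (x n) z)\<^sup>2 + 2 * (e (x (Suc n)) z)\<^sup>2 - 4 * (e m z)\<^sup>2 \<partial>M)"
      proof (intro Bochner_Integration.integral_cong refl)
        fix z assume "z \<in> space M"
        with m(2) have "e m z = (e (x n) z + e (x (Suc n)) z) / 2" by simp
        then show "(e (x (Suc n)) z - e (x n) z)\<^sup>2
            = 2 * (e (x n) z)\<^sup>2 + 2 * (e (x (Suc n)) z)\<^sup>2 - 4 * (e m z)\<^sup>2"
          by (simp only:) (simp add: power2_eq_square field_simps)
      qed
      also have "\<dots> = 2 * N (x n) + 2 * N (x (Suc n)) - 4 * N m"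
        using intN[OF xA] intN[OF mA] by (simp add: N_def)
      also have "\<dots> \<le> 2 * (d + \<delta> n) + 2 * (d + \<delta> n) - 4 * (d - \<delta> n)"
      proof -
        have "\<delta> (Suc n) \<le> \<delta> n" by (simp add: \<delta>_def)
        then show ?thesis using x(2)[of n] x(2)[of "Suc n"] \<nu>_le[OF m(1)] \<nu>E[of n] by simp
      qed
      finally show ?thesis by (simp add: \<delta>_def)
    qed
  qed
  have "\<exists>c\<in>E n. N c < d + \<delta> n" for n
    using \<nu>_near[OF E, of n "d + \<delta> n"] \<nu>d[OF E, of n] \<delta>[of n] by auto
  then obtain x where x: "\<And>n. x n \<in> E n" "\<And>n. N (x n) < d + \<delta> n" by metis
  have "\<exists>x'. range x' \<subseteq> C \<and> (AE z in M. convergent (\<lambda>n. e (if even n then x n else x' n) z))" if C: "C \<in> \<C>" for C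
  proof -
    \<comment> \<open>\<open>C \<inter> E n\<close> again belongs to \<open>\<C>\<close>, so its
      minimal norm is still at most \<open>d\<close>: restricting to \<open>C\<close> costs nothing
      in the limit.\<close>
    have "\<exists>c\<in>C \<inter> E n. N c < d + \<delta> n" for n
      using \<nu>_near[OF Int[OF C E], of n "d + \<delta> n"] \<nu>d[OF Int[OF C E], of n] \<delta>[of n] by auto
    then obtain x' where x': "\<And>n. x' n \<in> C" "\<And>n. x' n \<in> E n" "\<And>n. N (x' n) < d + \<delta> n" by (metis IntE)
    show ?thesis using x x' by (intro exI[of _ x'] conjI conv) auto
  qed
  moreover have "range x \<subseteq> A" using x E sub by blast
  ultimately show ?thesis using conv[OF x] by blast
qed

text \<open>Here \<open>e\<close> supplies the Hilbert space coordinates and \<open>V\<close> the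
  costs. They are linked by common mixtures in \<open>mixA\<close> and by \<open>closed\<close>, the
  substitute for compactness: convergent coordinates force all costs to converge to those of one
  element.\<close>

lemma (in prob_space) one_sided_minimax:
  fixes e :: "'c \<Rightarrow> 'a \<Rightarrow> real" and V :: "'c \<Rightarrow> 'b \<Rightarrow> real"
  assumes meas: "\<And>x. x \<in> A \<Longrightarrow> e x \<in> borel_measurable M"
    and bnd: "\<And>x z. x \<in> A \<Longrightarrow> z \<in> space M \<Longrightarrow> \<bar>e x z\<bar> \<le> 1"
    and A: "A \<noteq> {}"
    and V_bdd: "\<And>x y. x \<in> A \<Longrightarrow> y \<in> B \<Longrightarrow> \<bar>V x y\<bar> \<le> K"
    and mixA: "\<And>x x' t. x \<in> A \<Longrightarrow> x' \<in> A \<Longrightarrow> 0 \<le> t \<Longrightarrow> t \<le> 1 \<Longrightarrow>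
      \<exists>m\<in>A. (\<forall>y\<in>B. V m y = (1 - t) * V x y + t * V x' y) \<and>
             (\<forall>z\<in>space M. e m z = (1 - t) * e x z + t * e x' z)"
    and mixB: "\<And>y y' t. y \<in> B \<Longrightarrow> y' \<in> B \<Longrightarrow> 0 \<le> t \<Longrightarrow> t \<le> 1 \<Longrightarrow>
      \<exists>m\<in>B. \<forall>x\<in>A. V x m = (1 - t) * V x y + t * V x y'"
    and closed: "\<And>x. range x \<subseteq> A \<Longrightarrow> (AE z in M. convergent (\<lambda>n. e (x n) z)) \<Longrightarrow>
      \<exists>a\<in>A. \<forall>y\<in>B. (\<lambda>n. V (x n) y) \<longlonglongrightarrow> V a y"
    and best: "\<And>y \<epsilon>. y \<in> B \<Longrightarrow> 0 < \<epsilon> \<Longrightarrow> \<exists>x\<in>A. V x y \<le> w + \<epsilon>"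
  shows "\<exists>a\<in>A. \<forall>y\<in>B. V a y \<le> w"
proof -
  \<comment> \<open>Each opponent policy comes with a positive slack because the finite minimax step
    gives only approximate solutions; the slack disappears after the limit. With finite sets of
    pairs as indices, intersections correspond to unions, and the empty index gives \<open>A\<close>
    itself.\<close>
  define L where "L T = {x\<in>A. \<forall>(y, \<epsilon>)\<in>T. V x y \<le> w + \<epsilon>}" for T
  define \<C> where "\<C> = L ` {T. finite T \<and> T \<subseteq> B \<times> {0<..}}"
  have L_ne: "L T \<noteq> {}" if T: "finite T" "T \<subseteq> B \<times> {0<..}" for T
  proof -
    \<comment> \<open>One slack for all of \<open>T\<close>: half pays for the approximate best
      reply and half for the finite minimax step. The inserted 1 covers the empty
      \<open>T\<close>.\<close>
    define \<epsilon> where "\<epsilon> = Min (insert 1 (snd ` T))"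
    have \<epsilon>: "\<epsilon> > 0" "\<And>y \<eta>. (y, \<eta>) \<in> T \<Longrightarrow> \<epsilon> \<le> \<eta>"
    proof -
      show "\<epsilon> > 0" using T by (auto simp: \<epsilon>_def)
      show "\<epsilon> \<le> \<eta>" if "(y, \<eta>) \<in> T" for y \<eta>
        unfolding \<epsilon>_def using T that by (intro Min_le) force+
    qed
    have S: "finite (fst ` T)" "fst ` T \<subseteq> B" using T by auto
    have "\<exists>x\<in>A. \<forall>y\<in>fst ` T. V x y \<le> (w + \<epsilon>/2) + \<epsilon>/2"
    proof (rule finite_minimax[OF S(1) A])
      fix p assume p: "\<And>y. y \<in> fst ` T \<Longrightarrow> 0 \<le> p y" "sum p (fst ` T) = (1::real)"
      obtain b where b: "b \<in> B" "\<forall>x\<in>A. V x b = (\<Sum>y\<in>fst ` T. p y * V x y)"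
        using finite_mixture[of B A V "fst ` T" p, OF mixB S p] by blast
      then show "\<exists>x\<in>A. (\<Sum>y\<in>fst ` T. p y * V x y) \<le> w + \<epsilon>/2"
        using best[OF b(1), of "\<epsilon>/2"] \<epsilon> by auto
    next
      show "\<epsilon> / 2 > 0" using \<epsilon> by simp
      show "\<bar>V x y\<bar> \<le> K" if "x \<in> A" "y \<in> fst ` T" for x y using V_bdd that S by blast
      show "\<exists>m\<in>A. \<forall>y\<in>fst ` T. V m y = (1 - t) * V x y + t * V x' y"
        if "x \<in> A" "x' \<in> A" "0 \<le> t" "t \<le> 1" for x x' t
        using mixA[OF that] S(2) by (meson subsetD)
    qed
    then obtain x where "x \<in> A" "\<forall>y\<in>fst ` T. V x y \<le> w + \<epsilon>" by (auto simp: add.commute)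
    then have "x \<in> L T" using \<epsilon>(2) by (force simp: L_def)
    then show ?thesis by auto
  qed
  have "\<exists>x. range x \<subseteq> A \<and> (AE z in M. convergent (\<lambda>n. e (x n) z)) \<and>
    (\<forall>C\<in>\<C>. \<exists>x'. range x' \<subseteq> C \<and> (AE z in M. convergent (\<lambda>n. e (if even n then x n else x' n) z)))"
  proof (rule min_norm_sequence[OF meas bnd])
    show "\<C> \<noteq> {}" unfolding \<C>_def by auto
    show "C \<subseteq> A" if "C \<in> \<C>" for C using that by (auto simp: \<C>_def L_def)
    show "C \<noteq> {}" if "C \<in> \<C>" for C using that L_ne by (auto simp: \<C>_def)
    have L_Int: "L T \<inter> L T' = L (T \<union> T')" for T T' by (auto simp: L_def)
    show "C \<inter> D \<in> \<C>" if "C \<in> \<C>" "D \<in> \<C>" for C D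
      using that by (auto simp: \<C>_def L_Int)
    show "\<exists>m\<in>C. \<forall>z\<in>space M. e m z = (e a z + e b z) / 2" if "C \<in> \<C>" "a \<in> C" "b \<in> C" for C a b
    proof -
      obtain T where C: "C = L T" "T \<subseteq> B \<times> {0<..}" using \<open>C \<in> \<C>\<close> by (auto simp: \<C>_def)
      obtain m where m: "m \<in> A" "\<forall>y\<in>B. V m y = (1 - 1/2) * V a y + 1/2 * V b y"
         "\<forall>z\<in>space M. e m z = (1 - 1/2) * e a z + 1/2 * e b z"
        using mixA[of a b "1/2"] \<open>a \<in> C\<close> \<open>b \<in> C\<close> C by (auto simp: L_def)
      have "V m y \<le> w + \<epsilon>" if T: "(y, \<epsilon>) \<in> T" for y \<epsilon>
      proof -
        have "V a y \<le> w + \<epsilon>" "V b y \<le> w + \<epsilon>" "y \<in> B"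
          using T C \<open>a \<in> C\<close> \<open>b \<in> C\<close> by (auto simp: L_def)
        then show ?thesis using m(2) by simp
      qed
      then show ?thesis using m C by (intro bexI[of _ m]) (auto simp: L_def field_simps)
    qed
  qed
  then obtain x where x: "range x \<subseteq> A" "AE z in M. convergent (\<lambda>n. e (x n) z)"
    and x': "\<And>C. C \<in> \<C> \<Longrightarrow> \<exists>x'. range x' \<subseteq> C \<and>
      (AE z in M. convergent (\<lambda>n. e (if even n then x n else x' n) z))" by blast
  \<comment> \<open>\<open>a\<close> is fixed before any constraint is chosen; the sequences
    \<open>x'\<close> below only test it.\<close>
  obtain a where a: "a \<in> A" "\<forall>y\<in>B. (\<lambda>n. V (x n) y) \<longlonglongrightarrow> V a y" using closed[OF x] by blast
  have "V a y \<le> w + \<epsilon>" if y: "y \<in> B" and \<epsilon>: "\<epsilon> > 0" for y \<epsilon>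
  proof -
    have "L {(y, \<epsilon>)} \<in> \<C>" using y \<epsilon> by (auto simp: \<C>_def)
    then obtain x' where x': "range x' \<subseteq> L {(y, \<epsilon>)}" and
      *: "AE z in M. convergent (\<lambda>n. e (if even n then x n else x' n) z)" using x' by blast
    have "range (\<lambda>n. if even n then x n else x' n) \<subseteq> A" using x(1) x' by (auto simp: L_def)
    from closed[OF this *] obtain a' where
      a': "a' \<in> A" "(\<lambda>n. V (if even n then x n else x' n) y) \<longlonglongrightarrow> V a' y" using y by blast
    \<comment> \<open>The even terms tie \<open>a'\<close> to \<open>a\<close>, the odd terms carry
      the constraint.\<close>
    have "(\<lambda>n. V (x (2 * n)) y) \<longlonglongrightarrow> V a y"
      using LIMSEQ_subseq_LIMSEQ[of _ _ "\<lambda>n. 2 * n"] a y by (force simp: comp_def strict_mono_def)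
    moreover have "(\<lambda>n. V (x (2 * n)) y) \<longlonglongrightarrow> V a' y"
      using LIMSEQ_subseq_LIMSEQ[OF a'(2), of "\<lambda>n. 2 * n"] by (simp add: comp_def strict_mono_def)
    ultimately have eq: "V a y = V a' y" by (rule LIMSEQ_unique)
    have "(\<lambda>n. V (x' (2 * n + 1)) y) \<longlonglongrightarrow> V a' y"
      using LIMSEQ_subseq_LIMSEQ[OF a'(2), of "\<lambda>n. 2 * n + 1"] by (simp add: comp_def strict_mono_def)
    then show ?thesis unfolding eq
      by (rule LIMSEQ_le_const2) (use x' in \<open>auto simp: L_def image_subset_iff\<close>)
  qed
  then have "V a y \<le> w" if "y \<in> B" for y using that by (meson field_le_epsilon)
  then show ?thesis using a by blast
qed

section \<open>Weak limits on compact sets\<close>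

text \<open>With digits 0 and 2 in base 3, as for the Cantor set, the first differing digit
  contributes \<open>2 * (1/3) ^ Suc m\<close> and all later ones together at most
  \<open>(1/3) ^ Suc m\<close>. In base 2 with digits 0 and 1 the two could cancel and codes could
  collide.\<close>

lemma ternary_code_dist:
  fixes b b' :: "nat \<Rightarrow> bool"
  assumes "b n \<noteq> b' n"
  shows "(1/3) ^ Suc n \<le> \<bar>(\<Sum>i. of_bool (b i) * 2 * (1/3::real) ^ Suc i) - (\<Sum>i. of_bool (b' i) * 2 * (1/3) ^ Suc i)\<bar>"
proof -
  define m where "m = (LEAST i. b i \<noteq> b' i)"
  have m: "b m \<noteq> b' m" "m \<le> n" "\<And>i. i < m \<Longrightarrow> b i = b' i"
  proof -
    show "b m \<noteq> b' m" unfolding m_def by (rule LeastI[of "\<lambda>i. b i \<noteq> b' i", OF assms])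
    show "m \<le> n" unfolding m_def by (rule Least_le[of "\<lambda>i. b i \<noteq> b' i", OF assms])
    show "b i = b' i" if "i < m" for i
      using not_less_Least[OF that[unfolded m_def]] by simp
  qed
  define c where "c i = (of_bool (b i) - of_bool (b' i)) * 2 * (1/3::real) ^ Suc i" for i
  have sm: "summable (\<lambda>i. of_bool (p i) * 2 * (1/3::real) ^ Suc i)" for p :: "nat \<Rightarrow> bool"
    by (rule summable_comparison_test'[of "\<lambda>i. 2/3 * (1/3::real) ^ i" 0])
      (auto intro!: summable_mult summable_geometric)
  have c: "summable c" unfolding c_def left_diff_distrib by (intro summable_diff sm)
  have eq: "(\<Sum>i. of_bool (b i) * 2 * (1/3::real) ^ Suc i) - (\<Sum>i. of_bool (b' i) * 2 * (1/3) ^ Suc i) = suminf c"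
    unfolding c_def left_diff_distrib by (rule suminf_diff[OF sm sm])
  have "suminf c = (\<Sum>i. c (i + Suc m)) + (\<Sum>i<Suc m. c i)"
    by (rule suminf_split_initial_segment[OF c])
  also have "(\<Sum>i<Suc m. c i) = c m" using m(3) by (simp add: c_def)
  finally have s: "suminf c = (\<Sum>i. c (i + Suc m)) + c m" .
  have "\<bar>\<Sum>i. c (i + Suc m)\<bar> \<le> (\<Sum>i. 2 * (1/3) ^ Suc (Suc m) * (1/3::real) ^ i)"
  proof -
    have g: "summable (\<lambda>i. 2 * (1/3) ^ Suc (Suc m) * (1/3::real) ^ i)"
      by (intro summable_mult summable_geometric) auto
    have le: "norm (c (i + Suc m)) \<le> 2 * (1/3) ^ Suc (Suc m) * (1/3::real) ^ i" for i
      by (auto simp: c_def of_bool_def power_add abs_mult)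
    have "summable (\<lambda>i. norm (c (i + Suc m)))"
      by (rule summable_comparison_test'[OF g, of 0]) (use le in auto)
    then show ?thesis
      using summable_norm[of "\<lambda>i. c (i + Suc m)"] suminf_le[OF le _ g] by simp
  qed
  also have "\<dots> = (1/3) ^ Suc m"
    by (subst suminf_mult) (auto simp: suminf_geometric summable_geometric)
  finally have "\<bar>\<Sum>i. c (i + Suc m)\<bar> \<le> (1/3) ^ Suc m" .
  moreover have "\<bar>c m\<bar> = 2 * (1/3) ^ Suc m" using m(1) by (auto simp: c_def of_bool_def)
  ultimately have "(1/3) ^ Suc m \<le> \<bar>suminf c\<bar>" unfolding s by linarith
  moreover have "(1/3::real) ^ Suc n \<le> (1/3) ^ Suc m" using m(2) by (intro power_decreasing) auto
  ultimately show ?thesis unfolding eq by linarith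
qed

text \<open>The digits of \<open>s\<close> record which balls of finite nets contain the point. The
  inverse of \<open>s\<close> is uniformly continuous even where \<open>s\<close> jumps, so it
  extends to the closure \<open>K\<close> of the codes. Weak limits of laws of codes may charge
  \<open>K\<close> outside the codes, hence \<open>h\<close> is wanted on all of
  \<open>K\<close>.\<close>

lemma compact_real_code:
  fixes U :: "'u::polish_space set"
  assumes "compact U"
  obtains s :: "'u \<Rightarrow> real" and K h where "s \<in> borel_measurable borel" "range s \<subseteq> {0..1}"
    "compact K" "s ` U \<subseteq> K" "K \<subseteq> {0..1}" "continuous_on K h" "h ` K \<subseteq> U" "\<forall>u\<in>U. h (s u) = u"
proof -
  have "\<exists>F. finite F \<and> U \<subseteq> (\<Union>x\<in>F. ball x (1 / real (Suc n)))" for n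
  proof -
    obtain F where "finite F" "F \<subseteq> U" "U \<subseteq> (\<Union>x\<in>F. ball x (1 / real (Suc n)))"
      using compactE_image[OF assms, of U "\<lambda>x. ball x (1 / real (Suc n))"] by force
    then show ?thesis by blast
  qed
  then obtain F where F: "\<And>n. finite (F n)" "\<And>n. U \<subseteq> (\<Union>x\<in>F n. ball x (1 / real (Suc n)))" by metis
  \<comment> \<open>The empty set keeps \<open>Bs\<close> nonempty even for empty \<open>U\<close>,
    so that \<open>from_nat_into\<close> enumerates it exactly.\<close>
  define Bs where "Bs = insert {} (\<Union>n. (\<lambda>x. ball x (1 / real (Suc n))) ` F n)"
  have "countable Bs" unfolding Bs_def using F(1) by (intro countable_insert countable_UN) (auto intro: countable_finite)
  define B where "B = from_nat_into Bs"
  have rB: "range B = Bs" unfolding B_def using \<open>countable Bs\<close> by (intro range_from_nat_into) (auto simp: Bs_def)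
  have [measurable]: "B i \<in> sets borel" for i
  proof -
    have "B i \<in> Bs" using rB by auto
    then show ?thesis by (auto simp: Bs_def)
  qed
  define s :: "'u \<Rightarrow> real" where "s u = (\<Sum>i. of_bool (u \<in> B i) * 2 * (1/3) ^ Suc i)" for u
  have sm: "summable (\<lambda>i. of_bool (u \<in> B i) * 2 * (1/3::real) ^ Suc i)" for u
    by (rule summable_comparison_test'[of "\<lambda>i. 2/3 * (1/3::real) ^ i" 0])
      (auto intro!: summable_mult summable_geometric)
  have s_meas: "s \<in> borel_measurable borel" unfolding s_def by measurable
  have s0: "0 \<le> s u" for u unfolding s_def by (intro suminf_nonneg sm) auto
  have s1: "s u \<le> 1" for u
  proof -
    have "s u \<le> (\<Sum>i. 2/3 * (1/3::real) ^ i)" unfolding s_def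
      by (intro suminf_le sm) (auto intro!: summable_mult summable_geometric)
    also have "\<dots> = 1" by (subst suminf_mult) (auto simp: suminf_geometric summable_geometric)
    finally show ?thesis .
  qed
  have sep: "\<exists>\<delta>>0. \<forall>u\<in>U. \<forall>v\<in>U. \<bar>s u - s v\<bar> < \<delta> \<longrightarrow> dist u v < e" if e: "e > 0" for e
  proof -
    obtain n where n: "1 / real (Suc n) < e / 2" using nat_approx_posE[of "e/2"] e by auto
    have "\<exists>i. B i = ball x (1 / real (Suc n))" if "x \<in> F n" for x
    proof -
      have "ball x (1 / real (Suc n)) \<in> range B" unfolding rB Bs_def using that by auto
      then show ?thesis by (auto simp: eq_commute)
    qed
    then obtain i where i: "\<And>x. x \<in> F n \<Longrightarrow> B (i x) = ball x (1 / real (Suc n))" by metis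
    \<comment> \<open>A bound on the digit positions of the balls in the net \<open>F n\<close>.
      Codes closer than \<open>(1/3) ^ Suc J\<close> agree on all these balls, so both points lie in
      a common one.\<close>
    define J where "J = Max (insert 0 (i ` F n))"
    have J: "i x \<le> J" if "x \<in> F n" for x unfolding J_def using F(1) that by (intro Max_ge) auto
    show ?thesis
    proof (intro exI[of _ "(1/3) ^ Suc J"] conjI ballI impI)
      fix u v assume uv: "u \<in> U" "v \<in> U" "\<bar>s u - s v\<bar> < (1/3) ^ Suc J"
      obtain x where x: "x \<in> F n" "u \<in> ball x (1 / real (Suc n))" using F(2) uv by blast
      have "u \<in> B (i x) \<longleftrightarrow> v \<in> B (i x)"
      proof (rule ccontr)
        assume "\<not> ?thesis"
        then have "(1/3) ^ Suc (i x) \<le> \<bar>s u - s v\<bar>"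
          unfolding s_def by (intro ternary_code_dist) auto
        moreover have "(1/3::real) ^ Suc J \<le> (1/3) ^ Suc (i x)"
          using J[OF x(1)] by (intro power_decreasing) auto
        ultimately show False using uv(3) by linarith
      qed
      then have "dist x u < 1 / real (Suc n)" "dist x v < 1 / real (Suc n)" using x i by auto
      then show "dist u v < e" using n dist_triangle3[of u v x] by linarith
    qed simp
  qed
  have inj: "inj_on s U"
  proof (rule inj_onI)
    fix u v assume uv: "u \<in> U" "v \<in> U" "s u = s v"
    have "dist u v < e" if "e > 0" for e using sep[OF that] uv by auto
    then show "u = v" by (meson dist_pos_lt order_less_irrefl)
  qed
  have "uniformly_continuous_on (s ` U) (inv_into U s)"
    unfolding uniformly_continuous_on_def
  proof (intro allI impI)
    fix e :: real assume "e > 0"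
    then obtain \<delta> where "\<delta> > 0" "\<forall>u\<in>U. \<forall>v\<in>U. \<bar>s u - s v\<bar> < \<delta> \<longrightarrow> dist u v < e" using sep by blast
    then show "\<exists>d>0. \<forall>x\<in>s ` U. \<forall>x'\<in>s ` U. dist x' x < d \<longrightarrow> dist (inv_into U s x') (inv_into U s x) < e"
      using inj by (intro exI[of _ \<delta>]) (auto simp: dist_real_def)
  qed
  then obtain h where h: "uniformly_continuous_on (closure (s ` U)) h" "\<And>x. x \<in> s ` U \<Longrightarrow> inv_into U s x = h x"
    by (rule uniformly_continuous_on_extension_on_closure) blast
  have hs: "h (s u) = u" if "u \<in> U" for u using h(2)[of "s u"] inj that by auto
  have hc: "continuous_on (closure (s ` U)) h" using h(1) by (rule uniformly_continuous_imp_continuous)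
  have cl: "closure (s ` U) \<subseteq> {0..1}" using s0 s1 by (intro closure_minimal) auto
  show ?thesis
  proof (rule that[OF s_meas _ _ closure_subset cl hc])
    show "range s \<subseteq> {0..1}" using s0 s1 by auto
    show "\<forall>u\<in>U. h (s u) = u" using hs by simp
    show "compact (closure (s ` U))" using cl bounded_subset[OF bounded_closed_interval] by (auto simp: compact_eq_bounded_closed)
    have "h ` closure (s ` U) \<subseteq> closure (h ` s ` U)" by (rule image_closure_subset[OF hc _ closure_subset]) (auto simp: closure_subset)
    also have "h ` s ` U = U" using hs by (force simp: image_iff)
    also have "closure U = U" using assms by (simp add: compact_imp_closed)
    finally show "h ` closure (s ` U) \<subseteq> U" .
  qed
qed

text \<open>
  By the Weierstrass theorem and Tietze extension, convergence of the moments of \<open>s\<close> forces weak convergence.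
\<close>

definition moment_code :: "'u::polish_space set \<Rightarrow> ('u \<Rightarrow> real) \<Rightarrow> bool" where
  "moment_code U s \<longleftrightarrow> s \<in> borel_measurable borel \<and> (\<forall>u. 0 \<le> s u \<and> s u \<le> 1) \<and>
     (\<forall>M. (\<forall>n. M n \<in> space (prob_algebra (borel_sub U))) \<and> (\<forall>k. convergent (\<lambda>n. \<integral>u. s u ^ k \<partial>M n)) \<longrightarrow>
       (\<exists>L\<in>space (prob_algebra (borel_sub U)). \<forall>\<phi>::'u \<Rightarrow> real. continuous_on U \<phi> \<longrightarrow>
          (\<lambda>n. \<integral>u. \<phi> u \<partial>M n) \<longlonglongrightarrow> (\<integral>u. \<phi> u \<partial>L)))"

lemma prob_algebra_borel_subD:
  assumes "M \<in> space (prob_algebra (borel_sub U))"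
  shows "prob_space M" "sets M = sets (restrict_space borel U)" "space M = U"
  using assms sets_eq_imp_space_eq[of M "restrict_space borel U"]
  by (auto simp: space_prob_algebra borel_sub_def space_restrict_space)

text \<open>The laws of \<open>s\<close> under \<open>M n\<close> live on \<open>[0, 1]\<close>, so
  they are tight and a subsequence converges weakly to some \<open>N\<close>; decoding
  \<open>N\<close> gives \<open>L\<close>. The moments control the full sequence: they make the
  integrals of each \<open>\<phi>\<close> Cauchy, and the subsequence identifies the limit.\<close>

lemma moment_code_exists:
  fixes U :: "'u::polish_space set"
  assumes "compact U"
  shows "\<exists>s. moment_code U s"
proof -
  obtain s :: "'u \<Rightarrow> real" and K h where s[measurable]: "s \<in> borel_measurable borel" and s01: "range s \<subseteq> {0..1}"
    and K: "compact K" "s ` U \<subseteq> K" "K \<subseteq> {0..1}" and h: "continuous_on K h" "h ` K \<subseteq> U" and hs: "\<forall>u\<in>U. h (s u) = u"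
    by (rule compact_real_code[OF assms])
  have s0: "0 \<le> s u" and s1: "s u \<le> 1" for u using s01 by (auto simp: image_subset_iff)
  have Kcl: "closed K" using K by (simp add: compact_imp_closed)
  have "\<exists>L\<in>space (prob_algebra (borel_sub U)). \<forall>\<phi>::'u \<Rightarrow> real. continuous_on U \<phi> \<longrightarrow>
          (\<lambda>n. \<integral>u. \<phi> u \<partial>M n) \<longlonglongrightarrow> (\<integral>u. \<phi> u \<partial>L)"
    if M: "\<And>n. M n \<in> space (prob_algebra (borel_sub U))" and mom: "\<And>k. convergent (\<lambda>n. \<integral>u. s u ^ k \<partial>M n)" for M
  proof -
    note MD = prob_algebra_borel_subD[OF M]
    interpret M: prob_space "M n" for n by (rule MD)
    have sM[measurable]: "s \<in> borel_measurable (M n)" for n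
      using measurable_restrict_space1[OF s, of U] MD(2) by (simp cong: measurable_cong_sets)
    define P where "P n = distr (M n) borel s" for n
    interpret P: real_distribution "P n" for n
      unfolding P_def real_distribution_def real_distribution_axioms_def
      by (auto intro!: M.prob_space_distr)
    have tight: "tight P"
      unfolding tight_def
    proof (intro conjI allI impI)
      show "real_distribution (P n)" for n by unfold_locales
      show "\<exists>a b. a < b \<and> (\<forall>n. 1 - \<epsilon> < measure (P n) {a<..b})" if "\<epsilon> > 0" for \<epsilon>
      proof (rule exI[of _ "-1"], rule exI[of _ 2], intro conjI allI)
        fix n
        have "-1 < s u" "s u \<le> 2" for u using s0[of u] s1[of u] by linarith+
        then have "s -` {-1<..2} \<inter> space (M n) = space (M n)" by auto
        then have "measure (P n) {-1<..2} = 1" unfolding P_def by (simp add: measure_distr M.prob_space)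
        then show "1 - \<epsilon> < measure (P n) {-1<..2}" using that by simp
      qed simp
    qed
    then obtain r N where r: "strict_mono (r :: nat \<Rightarrow> nat)" and "real_distribution N" and
      wc: "weak_conv_m (P \<circ> id \<circ> r) N"
      using tight_imp_convergent_subsubsequence[of P id] by (auto simp: strict_mono_def)
    interpret N: real_distribution N by fact
    have lim: "(\<lambda>n. \<integral>x. f x \<partial>P (r n)) \<longlonglongrightarrow> (\<integral>x. f x \<partial>N)"
      if f: "continuous_on UNIV f" "\<And>x. norm (f x) \<le> B" for f :: "real \<Rightarrow> real" and B
    proof -
      have "real_distribution ((P \<circ> id \<circ> r) n)" for n by (simp add: P.real_distribution_axioms)
      then show ?thesis
        using weak_conv_imp_integral_bdd_continuous_conv[OF _ N.real_distribution_axioms wc, of f B] f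
        by (simp add: continuous_on_eq_continuous_at)
    qed
    have Pint: "(\<integral>x. f x \<partial>P n) = (\<integral>u. f (s u) \<partial>M n)" if "continuous_on UNIV f" for f :: "real \<Rightarrow> real" and n
      unfolding P_def using that by (intro integral_distr) (auto intro: borel_measurable_continuous_onI)
    \<comment> \<open>the limit law charges only \<open>K\<close>, where the decoding map \<open>h\<close> is defined\<close>
    have NK: "AE x in N. x \<in> K"
    proof (cases "K = {}")
      case True
      then have "U = {}" using K by auto
      then show ?thesis using M.not_empty[of 0] MD(3) by auto
    next
      case False
      \<comment> \<open>A bounded continuous function that vanishes exactly on the nonempty closed
        set \<open>K\<close>. It integrates to 0 under every \<open>P n\<close>, because codes of
        points of \<open>U\<close> lie in \<open>K\<close>, and weak convergence passes this on to
        \<open>N\<close>.\<close>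
      define f where "f x = min 1 (infdist x K)" for x
      have fc: "continuous_on UNIV f" unfolding f_def by (intro continuous_intros)
      have f0: "0 \<le> f x" "f x \<le> 1" for x unfolding f_def by (auto simp: infdist_nonneg)
      have "f \<in> borel_measurable borel" using fc by (rule borel_measurable_continuous_onI)
      then have fN: "integrable N f" using f0 by (intro N.integrable_const_bound[of _ 1]) auto
      have "(\<integral>u. f (s u) \<partial>M n) = 0" for n
      proof -
        have "f (s u) = 0" if "u \<in> space (M n)" for u using that MD(3)[of n] K(2) by (auto simp: f_def image_subset_iff)
        then show ?thesis by (simp cong: Bochner_Integration.integral_cong)
      qed
      then have "(\<integral>x. f x \<partial>P (r n)) = 0" for n using Pint[OF fc] by simp
      then have "(\<integral>x. f x \<partial>N) = 0" using lim[OF fc, of 1] f0 LIMSEQ_unique[OF tendsto_const] by force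
      then have "AE x in N. f x = 0" using fN f0 by (subst (asm) integral_nonneg_eq_0_iff_AE) auto
      then show ?thesis
        using in_closed_iff_infdist_zero[OF Kcl False] by (auto simp: f_def min_def split: if_splits)
    qed
    \<comment> \<open>A filler value off \<open>K\<close>, an \<open>N\<close>-null set, which makes
      the decoding total with values in \<open>U\<close>.\<close>
    define u0 where "u0 = (SOME u. u \<in> U)"
    have u0: "u0 \<in> U" using M.not_empty[of 0] MD(3)[of 0] unfolding u0_def by (simp add: some_in_eq)
    define g where "g x = (if x \<in> K then h x else u0)" for x
    have [measurable]: "K \<in> sets borel" using Kcl by simp
    have g_meas[measurable]: "g \<in> borel \<rightarrow>\<^sub>M borel_sub U"
      unfolding borel_sub_def
    proof (rule measurable_restrict_space2)
      show "g \<in> space borel \<rightarrow> U" using h(2) u0 by (auto simp: g_def image_subset_iff)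
      show "g \<in> borel_measurable borel" unfolding g_def
        using h(1) by (subst measurable_If_restrict_space_iff) (auto intro: borel_measurable_continuous_on_restrict)
    qed
    define L where "L = distr N (borel_sub U) g"
    have L: "L \<in> space (prob_algebra (borel_sub U))"
      unfolding L_def space_prob_algebra by (auto intro!: N.prob_space_distr)
    have "(\<lambda>n. \<integral>u. \<phi> u \<partial>M n) \<longlonglongrightarrow> (\<integral>u. \<phi> u \<partial>L)" if \<phi>: "continuous_on U \<phi>" for \<phi> :: "'u \<Rightarrow> real"
    proof -
      have "compact (\<phi> ` U)" using \<phi> assms by (rule compact_continuous_image)
      then obtain B where B: "\<And>u. u \<in> U \<Longrightarrow> norm (\<phi> u) \<le> B" "0 \<le> B"
        by (metis compact_imp_bounded bounded_pos image_eqI less_imp_le)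
      \<comment> \<open>\<open>\<phi>\<close> is continuous on \<open>U\<close> only, while weak
        convergence tests functions on the line: transport it by \<open>h\<close>, then extend it
        from the closed set \<open>K\<close> with the same bound.\<close>
      have "continuous_on K (\<phi> \<circ> h)" using h \<phi> by (intro continuous_on_compose) (auto intro: continuous_on_subset)
      then obtain \<psi> where \<psi>: "continuous_on UNIV \<psi>" "\<And>x. x \<in> K \<Longrightarrow> \<psi> x = (\<phi> \<circ> h) x" "\<And>x. norm (\<psi> x) \<le> B"
        using Tietze[of K "\<phi> \<circ> h" UNIV B] Kcl B h(2) by (auto simp: image_subset_iff)
      have \<phi>\<psi>: "\<phi> u = \<psi> (s u)" if "u \<in> U" for u using \<psi>(2)[of "s u"] hs K(2) that by auto
      have eqM: "(\<integral>u. \<phi> u \<partial>M n) = (\<integral>u. \<psi> (s u) \<partial>M n)" for n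
        using \<phi>\<psi> MD(3) by (intro Bochner_Integration.integral_cong) auto
      have \<phi>m[measurable]: "\<phi> \<in> borel_measurable (borel_sub U)"
        unfolding borel_sub_def using \<phi> by (rule borel_measurable_continuous_on_restrict)
      have [measurable]: "\<psi> \<in> borel_measurable borel" using \<psi>(1) by (rule borel_measurable_continuous_onI)
      have eqL: "(\<integral>u. \<phi> u \<partial>L) = (\<integral>x. \<psi> x \<partial>N)"
      proof -
        have "(\<integral>u. \<phi> u \<partial>L) = (\<integral>x. \<phi> (g x) \<partial>N)" unfolding L_def by (rule integral_distr) auto
        also have "\<dots> = (\<integral>x. \<psi> x \<partial>N)"
        proof (rule integral_cong_AE)
          show "(\<lambda>x. \<phi> (g x)) \<in> borel_measurable N" "\<psi> \<in> borel_measurable N" by auto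
          show "AE x in N. \<phi> (g x) = \<psi> x" using NK by eventually_elim (simp add: g_def \<psi>(2))
        qed
        finally show ?thesis .
      qed
      have sub: "(\<lambda>n. \<integral>u. \<phi> u \<partial>M (r n)) \<longlonglongrightarrow> (\<integral>u. \<phi> u \<partial>L)"
        unfolding eqM eqL using lim[OF \<psi>(1,3)] Pint[OF \<psi>(1)] by simp
      \<comment> \<open>A polynomial \<open>p\<close> within \<open>e / 4\<close> of
        \<open>\<psi>\<close> on \<open>[0, 1]\<close> costs \<open>e / 4\<close> at each of the two
        indices and leaves \<open>e / 2\<close> for the integrals of \<open>p\<close>, which are
        finite combinations of convergent moments.\<close>
      have "Cauchy (\<lambda>n. \<integral>u. \<phi> u \<partial>M n)"
      proof (rule metric_CauchyI)
        fix e :: real assume e: "e > 0"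
        obtain p where p: "real_polynomial_function p" "\<And>x. x \<in> {0..1} \<Longrightarrow> \<bar>\<psi> x - p x\<bar> < e / 4"
          using Stone_Weierstrass_real_polynomial_function[of "{0..1::real}" \<psi> "e/4"] e \<psi>(1)
          by (auto intro: continuous_on_subset)
        obtain a d where pa: "p = (\<lambda>x. \<Sum>i\<le>d. a i * x ^ i)"
          using p(1) real_polynomial_function_iff_sum by blast
        have sk: "integrable (M n) (\<lambda>u. s u ^ k)" for n k
          using s0 s1 by (intro M.integrable_const_bound[of _ 1]) (auto simp: power_le_one)
        have pint: "(\<integral>u. p (s u) \<partial>M n) = (\<Sum>i\<le>d. a i * (\<integral>u. s u ^ i \<partial>M n))" for n
          unfolding pa using sk by (subst Bochner_Integration.integral_sum) auto
        have "convergent (\<lambda>n. \<integral>u. p (s u) \<partial>M n)"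
          unfolding pint by (intro convergent_sum convergent_mult convergent_const mom)
        then obtain n0 where n0: "\<And>m n. m \<ge> n0 \<Longrightarrow> n \<ge> n0 \<Longrightarrow> dist (\<integral>u. p (s u) \<partial>M m) (\<integral>u. p (s u) \<partial>M n) < e / 2"
          using e by (metis convergent_Cauchy metric_CauchyD half_gt_zero)
        have close: "\<bar>(\<integral>u. \<psi> (s u) \<partial>M n) - (\<integral>u. p (s u) \<partial>M n)\<bar> \<le> e / 4" for n
        proof -
          have i1: "integrable (M n) (\<lambda>u. \<psi> (s u))" using \<psi>(3) by (intro M.integrable_const_bound[of _ B]) auto
          have i2: "integrable (M n) (\<lambda>u. p (s u))" unfolding pa using sk by auto
          have le: "\<bar>\<psi> (s u) - p (s u)\<bar> \<le> e / 4" for u using p(2)[of "s u"] s0 s1 by force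
          have "\<bar>(\<integral>u. \<psi> (s u) \<partial>M n) - (\<integral>u. p (s u) \<partial>M n)\<bar> = \<bar>\<integral>u. \<psi> (s u) - p (s u) \<partial>M n\<bar>"
            using i1 i2 by simp
          also have "\<dots> \<le> (\<integral>u. \<bar>\<psi> (s u) - p (s u)\<bar> \<partial>M n)" by (rule integral_abs_bound)
          also have "\<dots> \<le> (\<integral>u. e / 4 \<partial>M n)" using i1 i2 le by (intro integral_mono) auto
          also have "\<dots> = e / 4" by (simp add: M.prob_space)
          finally show ?thesis .
        qed
        show "\<exists>k. \<forall>m\<ge>k. \<forall>n\<ge>k. dist (\<integral>u. \<phi> u \<partial>M m) (\<integral>u. \<phi> u \<partial>M n) < e"
        proof (intro exI[of _ n0] allI impI)
          fix m n assume "m \<ge> n0" "n \<ge> n0"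
          then show "dist (\<integral>u. \<phi> u \<partial>M m) (\<integral>u. \<phi> u \<partial>M n) < e"
            using n0[of m n] close[of m] close[of n] e unfolding eqM dist_real_def by linarith
        qed
      qed
      then obtain l where l: "(\<lambda>n. \<integral>u. \<phi> u \<partial>M n) \<longlonglongrightarrow> l" by (metis Cauchy_convergent convergentD)
      moreover have "l = (\<integral>u. \<phi> u \<partial>L)"
        using LIMSEQ_unique[OF LIMSEQ_subseq_LIMSEQ[OF l r, unfolded comp_def] sub] .
      ultimately show ?thesis by simp
    qed
    then show ?thesis using L by blast
  qed
  then show ?thesis using s s0 s1 unfolding moment_code_def by blast
qed

section \<open>Policies\<close>

text \<open>Pushing \<open>L x\<close> forward along \<open>y \<mapsto> (x, y)\<close> moves the
  parameter into the measure; the integrand becomes one fixed function on the product.\<close>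

lemma integral_measurable_subprob_algebra2:
  fixes f :: "'a \<Rightarrow> 'b \<Rightarrow> real"
  assumes f[measurable]: "(\<lambda>(x, y). f x y) \<in> borel_measurable (M \<Otimes>\<^sub>M N)"
    and L[measurable]: "L \<in> measurable M (subprob_algebra N)"
  shows "(\<lambda>x. \<integral>y. f x y \<partial>L x) \<in> borel_measurable M"
proof -
  note integral_measurable_subprob_algebra[measurable] measurable_distr2[measurable]
  have "(\<lambda>x. integral\<^sup>L (distr (L x) (M \<Otimes>\<^sub>M N) (\<lambda>y. (x, y))) (\<lambda>(x, y). f x y)) \<in> borel_measurable M"
    by measurable
  then show ?thesis
    by (rule measurable_cong[THEN iffD1, rotated]) (simp add: integral_distr)
qed

lemma space_borel_sub[simp]: "space (borel_sub S) = S"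
  by (simp add: borel_sub_def space_restrict_space)

lemma policiesD:
  assumes "\<gamma> \<in> policies Y U" "y \<in> Y"
  shows "\<gamma> y \<in> space (prob_algebra (borel_sub U))" "prob_space (\<gamma> y)" "space (\<gamma> y) = U"
    "sets (\<gamma> y) = sets (borel_sub U)"
proof -
  show *: "\<gamma> y \<in> space (prob_algebra (borel_sub U))"
    using assms measurable_space[of \<gamma> "borel_sub Y" "prob_algebra (borel_sub U)" y] by (simp add: policies_def)
  show "prob_space (\<gamma> y)" "space (\<gamma> y) = U" "sets (\<gamma> y) = sets (borel_sub U)"
    using prob_algebra_borel_subD[OF *] by (auto simp: borel_sub_def)
qed

lemma policy_integral_measurable[measurable]:
  fixes \<phi> :: "'u::polish_space \<Rightarrow> real"
  assumes "\<gamma> \<in> policies Y U" "\<phi> \<in> borel_measurable (borel_sub U)"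
  shows "(\<lambda>y. \<integral>u. \<phi> u \<partial>\<gamma> y) \<in> borel_measurable (borel_sub Y)"
  using measurable_compose[OF measurable_prob_algebraD integral_measurable_subprob_algebra] assms
  unfolding policies_def by blast

text \<open>A biased coin chooses between \<open>\<gamma>'\<close> and \<open>\<gamma>\<close>. One
  \<open>m\<close> serves all bounded test functions, since moments and averaged costs must be mixed
  by the same policy.\<close>

lemma policy_mix:
  assumes g: "\<gamma> \<in> policies Y U" "\<gamma>' \<in> policies Y U" and t: "0 \<le> t" "t \<le> 1"
  shows "\<exists>m\<in>policies Y U. \<forall>y\<in>Y. \<forall>\<phi>::'u::polish_space \<Rightarrow> real. \<forall>K. \<phi> \<in> borel_measurable (borel_sub U) \<longrightarrow>
    (\<forall>u\<in>U. \<bar>\<phi> u\<bar> \<le> K) \<longrightarrow> (\<integral>u. \<phi> u \<partial>m y) = (1 - t) * (\<integral>u. \<phi> u \<partial>\<gamma> y) + t * (\<integral>u. \<phi> u \<partial>\<gamma>' y)"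
proof -
  define m where "m y = measure_pmf (bernoulli_pmf t) \<bind> (\<lambda>b. if b then \<gamma>' y else \<gamma> y)" for y
  have [measurable]: "\<gamma> \<in> borel_sub Y \<rightarrow>\<^sub>M prob_algebra (borel_sub U)" "\<gamma>' \<in> borel_sub Y \<rightarrow>\<^sub>M prob_algebra (borel_sub U)"
    using g by (auto simp: policies_def)
  have "m \<in> policies Y U"
    unfolding policies_def m_def
  proof (rule measurable_bind_prob_space2)
    show "(\<lambda>_. measure_pmf (bernoulli_pmf t)) \<in> borel_sub Y \<rightarrow>\<^sub>M prob_algebra (count_space UNIV)"
      by (intro measurable_const) (auto simp: space_prob_algebra prob_space_measure_pmf)
    show "(\<lambda>(x, y). if y then \<gamma>' x else \<gamma> x) \<in> borel_sub Y \<Otimes>\<^sub>M count_space UNIV \<rightarrow>\<^sub>M prob_algebra (borel_sub U)"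
      by measurable
  qed
  moreover have "(\<integral>u. \<phi> u \<partial>m y) = (1 - t) * (\<integral>u. \<phi> u \<partial>\<gamma> y) + t * (\<integral>u. \<phi> u \<partial>\<gamma>' y)"
    if y: "y \<in> Y" and \<phi>: "\<phi> \<in> borel_measurable (borel_sub U)" and K: "\<forall>u\<in>U. \<bar>\<phi> u\<bar> \<le> K" for y K and \<phi> :: "'u \<Rightarrow> real"
  proof -
    have "(\<integral>u. \<phi> u \<partial>m y) = (\<integral>b. (\<integral>u. \<phi> u \<partial>(if b then \<gamma>' y else \<gamma> y)) \<partial>measure_pmf (bernoulli_pmf t))"
      unfolding m_def
    proof (rule integral_bind[OF \<phi>, where B = K and B' = 1])
      have sp: "\<gamma> y \<in> space (subprob_algebra (borel_sub U))" "\<gamma>' y \<in> space (subprob_algebra (borel_sub U))"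
        using g y by (auto simp: space_subprob_algebra policiesD prob_space_imp_subprob_space)
      then show "(\<lambda>b. if b then \<gamma>' y else \<gamma> y) \<in> measure_pmf (bernoulli_pmf t) \<rightarrow>\<^sub>M subprob_algebra (borel_sub U)"
        by (auto simp: measurable_def)
      show "finite_measure (measure_pmf (bernoulli_pmf t))" by unfold_locales
      show "AE x in measure_pmf (bernoulli_pmf t). emeasure (if x then \<gamma>' y else \<gamma> y) (space (if x then \<gamma>' y else \<gamma> y)) \<le> ennreal 1"
        using policiesD[OF g(1) y] policiesD[OF g(2) y] by (auto simp: prob_space.emeasure_space_1)
    qed (use K in auto)
    also have "\<dots> = (1 - t) * (\<integral>u. \<phi> u \<partial>\<gamma> y) + t * (\<integral>u. \<phi> u \<partial>\<gamma>' y)"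
      using t by simp
    finally show ?thesis .
  qed
  ultimately show ?thesis by blast
qed

lemma policies_nonempty:
  assumes "U \<noteq> {}"
  shows "policies Y U \<noteq> {}"
proof -
  obtain u where "u \<in> U" using assms by auto
  then have "(\<lambda>_. return (borel_sub U) u) \<in> policies Y U"
    unfolding policies_def by (intro measurable_const) (auto simp: space_prob_algebra prob_space_return)
  then show ?thesis by auto
qed

lemma sets_borel_sub_closed:
  assumes "U \<in> sets borel"
  shows "sets (borel_sub U) = sigma_sets U ((\<inter>) U ` Collect closed)"
proof -
  have "sets (borel_sub U) = (\<inter>) U ` sigma_sets UNIV (Collect closed)"
    unfolding borel_sub_def sets_restrict_space borel_eq_closed by simp
  also have "\<dots> = sigma_sets U ((\<inter>) U ` Collect closed)"
    using assms by (intro sigma_sets_Int) (simp_all add: borel_eq_closed)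
  finally show ?thesis .
qed

text \<open>A limit policy arises by choice at each observation and is known only through integrals
  of continuous functions. These suffice: traces of closed sets form an intersection-stable
  generator, and indicators of closed sets are limits of continuous functions.\<close>

lemma policies_if_integrals_measurable:
  fixes \<gamma> :: "'y::polish_space \<Rightarrow> 'u::polish_space measure"
  assumes \<gamma>: "\<And>y. y \<in> Y \<Longrightarrow> \<gamma> y \<in> space (prob_algebra (borel_sub U))"
    and meas: "\<And>\<phi>::'u \<Rightarrow> real. continuous_on UNIV \<phi> \<Longrightarrow> (\<And>u. 0 \<le> \<phi> u \<and> \<phi> u \<le> 1) \<Longrightarrow>
      (\<lambda>y. \<integral>u. \<phi> u \<partial>\<gamma> y) \<in> borel_measurable (borel_sub Y)"
    and U: "U \<in> sets borel"
  shows "\<gamma> \<in> policies Y U"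
  unfolding policies_def
proof (rule measurable_prob_algebra_generated[OF sets_borel_sub_closed[OF U]])
  show "Int_stable ((\<inter>) U ` Collect closed)"
  proof (rule Int_stableI)
    fix a b assume "a \<in> (\<inter>) U ` Collect closed" "b \<in> (\<inter>) U ` Collect closed"
    then obtain A B where "a = U \<inter> A" "b = U \<inter> B" "closed A" "closed B" by auto
    then show "a \<inter> b \<in> (\<inter>) U ` Collect closed" by (intro image_eqI[of _ _ "A \<inter> B"]) auto
  qed
  note D = prob_algebra_borel_subD[OF \<gamma>]
  show "prob_space (\<gamma> y)" "sets (\<gamma> y) = sets (borel_sub U)" if "y \<in> space (borel_sub Y)" for y
    using D[of y] that[unfolded space_borel_sub] by (auto simp: borel_sub_def)
  show "(\<lambda>y. emeasure (\<gamma> y) A) \<in> borel_measurable (borel_sub Y)" if "A \<in> (\<inter>) U ` Collect closed" for A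
  proof -
    obtain C where C: "A = U \<inter> C" "closed C" using \<open>A \<in> _\<close> by auto
    show ?thesis
    proof (cases "C = {}")
      case True then show ?thesis using C by simp
    next
      case False
      \<comment> \<open>Equal to 1 on \<open>C\<close> and, for positive \<open>m\<close>, to 0 from
        distance \<open>1 / m\<close> on. The empty \<open>C\<close> is treated apart because
        \<open>infdist\<close> to it is 0.\<close>
      define \<phi> where "\<phi> m u = max 0 (1 - real m * infdist u C)" for m :: nat and u
      have \<phi>c: "continuous_on UNIV (\<phi> m)" for m unfolding \<phi>_def by (intro continuous_intros)
      have \<phi>01: "0 \<le> \<phi> m u \<and> \<phi> m u \<le> 1" for m u by (auto simp: \<phi>_def infdist_nonneg)
      have lim: "(\<lambda>m. \<phi> m u) \<longlonglongrightarrow> indicator C u" for u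
      proof (cases "u \<in> C")
        case True
        then show ?thesis by (simp add: \<phi>_def)
      next
        case u: False
        then have pos: "infdist u C > 0"
          using in_closed_iff_infdist_zero[OF C(2) False, of u] infdist_nonneg[of u C] by linarith
        obtain n0 :: nat where n0: "1 / infdist u C < n0" using reals_Archimedean2 by blast
        have "\<phi> m u = 0" if "m \<ge> n0" for m
        proof -
          have "1 / infdist u C < m" using n0 that by (meson less_le_trans of_nat_mono)
          then show ?thesis using pos by (simp add: \<phi>_def field_simps)
        qed
        then show ?thesis using u by (intro tendsto_eventually) (auto simp: eventually_sequentially)
      qed
      have "(\<lambda>y. measure (\<gamma> y) A) \<in> borel_measurable (borel_sub Y)"
      proof (rule borel_measurable_LIMSEQ_real)
        show "(\<lambda>y. \<integral>u. \<phi> m u \<partial>\<gamma> y) \<in> borel_measurable (borel_sub Y)" for m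
          using meas[OF \<phi>c \<phi>01] .
        fix y assume "y \<in> space (borel_sub Y)"
        then have y: "y \<in> Y" by simp
        interpret prob_space "\<gamma> y" by (rule D[OF y])
        have bm: "g \<in> borel_measurable (\<gamma> y)" if "g \<in> borel_measurable borel" for g :: "'u \<Rightarrow> real"
          using measurable_restrict_space1[OF that, of U] D(2)[OF y] by (simp cong: measurable_cong_sets)
        have "C \<in> sets borel" using C by simp
        then have "(\<lambda>m. \<integral>u. \<phi> m u \<partial>\<gamma> y) \<longlonglongrightarrow> (\<integral>u. indicator C u \<partial>\<gamma> y)"
          using lim \<phi>01 \<phi>c by (intro integral_dominated_convergence[where w="\<lambda>_. 1"] bm)
            (auto intro: borel_measurable_continuous_onI)
        also have "(\<integral>u. indicator C u \<partial>\<gamma> y) = measure (\<gamma> y) A"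
          using C(1) D(3)[OF y] by (simp add: Int_commute)
        finally show "(\<lambda>m. \<integral>u. \<phi> m u \<partial>\<gamma> y) \<longlonglongrightarrow> measure (\<gamma> y) A" .
      qed
      then have "(\<lambda>y. ennreal (measure (\<gamma> y) A)) \<in> borel_measurable (borel_sub Y)" by measurable
      then show ?thesis
        by (rule measurable_cong[THEN iffD1, rotated])
          (use D in \<open>simp add: finite_measure.emeasure_eq_measure prob_space.finite_measure\<close>)
    qed
  qed
qed auto

text \<open>The weak limits are chosen separately for each observation. Measurability survives the
  choice, because their integrals are forced to be pointwise limits of measurable functions on the
  measurable set \<open>G\<close> of convergence.\<close>

lemma policy_limit:
  fixes \<gamma> :: "nat \<Rightarrow> 'y::polish_space \<Rightarrow> 'u::polish_space measure"
  assumes s: "moment_code U s" and \<gamma>: "\<And>n. \<gamma> n \<in> policies Y U" and U: "U \<noteq> {}" "U \<in> sets borel"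
  shows "\<exists>L\<in>policies Y U. \<forall>y\<in>Y. (\<forall>k. convergent (\<lambda>n. \<integral>u. s u ^ k \<partial>\<gamma> n y)) \<longrightarrow>
    (\<forall>\<phi>::'u \<Rightarrow> real. continuous_on U \<phi> \<longrightarrow> (\<lambda>n. \<integral>u. \<phi> u \<partial>\<gamma> n y) \<longlonglongrightarrow> (\<integral>u. \<phi> u \<partial>L y))"
proof -
  obtain u0 where u0: "u0 \<in> U" using U by auto
  have s_meas[measurable]: "s \<in> borel_measurable (borel_sub U)"
    using s unfolding moment_code_def borel_sub_def by (blast intro: measurable_restrict_space1)
  define G where "G = {y\<in>space (borel_sub Y). \<forall>k. convergent (\<lambda>n. \<integral>u. s u ^ k \<partial>\<gamma> n y)}"
  note [measurable] = policy_integral_measurable[OF \<gamma>]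
  have [measurable]: "(\<lambda>y. \<integral>u. s u ^ k \<partial>\<gamma> n y) \<in> borel_measurable (borel_sub Y)" for n k
    by (intro policy_integral_measurable[OF \<gamma>]) measurable
  have [measurable]: "G \<in> sets (borel_sub Y)" unfolding G_def Cauchy_convergent_iff[symmetric] by measurable
  have "\<exists>L\<in>space (prob_algebra (borel_sub U)). \<forall>\<phi>::'u \<Rightarrow> real. continuous_on U \<phi> \<longrightarrow>
          (\<lambda>n. \<integral>u. \<phi> u \<partial>\<gamma> n y) \<longlonglongrightarrow> (\<integral>u. \<phi> u \<partial>L)" if "y \<in> G" for y
    using s that policiesD(1)[OF \<gamma>] unfolding moment_code_def G_def by simp
  then obtain L0 where L0: "\<And>y. y \<in> G \<Longrightarrow> L0 y \<in> space (prob_algebra (borel_sub U))"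
    "\<And>y \<phi>. y \<in> G \<Longrightarrow> continuous_on U (\<phi> :: 'u \<Rightarrow> real) \<Longrightarrow> (\<lambda>n. \<integral>u. \<phi> u \<partial>\<gamma> n y) \<longlonglongrightarrow> (\<integral>u. \<phi> u \<partial>L0 y)"
    by metis
  \<comment> \<open>Off \<open>G\<close> a fixed Dirac measure keeps \<open>L\<close> a policy; no
    convergence is claimed there.\<close>
  define L where "L y = (if y \<in> G then L0 y else return (borel_sub U) u0)" for y
  have "L \<in> policies Y U"
  proof (rule policies_if_integrals_measurable[OF _ _ U(2)])
    show "L y \<in> space (prob_algebra (borel_sub U))" for y
      using L0 u0 by (auto simp: L_def space_prob_algebra prob_space_return)
    fix \<phi> :: "'u \<Rightarrow> real" assume \<phi>: "continuous_on UNIV \<phi>"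
    have [measurable]: "\<phi> \<in> borel_measurable (borel_sub U)"
      unfolding borel_sub_def by (intro measurable_restrict_space1 borel_measurable_continuous_onI \<phi>)
    have "(\<lambda>y. if y \<in> G then lim (\<lambda>n. \<integral>u. \<phi> u \<partial>\<gamma> n y) else \<phi> u0) \<in> borel_measurable (borel_sub Y)"
      by measurable
    also have "(\<lambda>y. if y \<in> G then lim (\<lambda>n. \<integral>u. \<phi> u \<partial>\<gamma> n y) else \<phi> u0) = (\<lambda>y. \<integral>u. \<phi> u \<partial>L y)"
    proof
      fix y
      show "(if y \<in> G then lim (\<lambda>n. \<integral>u. \<phi> u \<partial>\<gamma> n y) else \<phi> u0) = (\<integral>u. \<phi> u \<partial>L y)"
        using limI[OF L0(2)[of y \<phi>]] continuous_on_subset[OF \<phi>] u0 by (auto simp: L_def integral_return)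
    qed
    finally show "(\<lambda>y. \<integral>u. \<phi> u \<partial>L y) \<in> borel_measurable (borel_sub Y)" .
  qed
  moreover have "(\<lambda>n. \<integral>u. \<phi> u \<partial>\<gamma> n y) \<longlonglongrightarrow> (\<integral>u. \<phi> u \<partial>L y)"
    if "y \<in> Y" "\<forall>k. convergent (\<lambda>n. \<integral>u. s u ^ k \<partial>\<gamma> n y)" "continuous_on U \<phi>" for y and \<phi> :: "'u \<Rightarrow> real"
    using that L0(2)[of y \<phi>] by (simp add: L_def G_def)
  ultimately show ?thesis by blast
qed

section \<open>Games\<close>

locale bounded_game =
  fixes X :: "'x::polish_space set" and Y1 :: "'y1::polish_space set" and Y2 :: "'y2::polish_space set"
    and U1 :: "'u1::polish_space set" and U2 :: "'u2::polish_space set"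
    and c :: "'x \<times> 'u1 \<times> 'u2 \<Rightarrow> real" and \<mu> :: "('x \<times> 'y1 \<times> 'y2) measure"
  assumes info: "\<mu> \<in> space (prob_algebra (info_space X Y1 Y2))"
    and game: "zero_sum_game X c U1 U2"
begin

sublocale prob_space \<mu>
  using info by (simp add: space_prob_algebra)

lemma sets_info[measurable_cong]: "sets \<mu> = sets (info_space X Y1 Y2)"
  using info by (simp add: space_prob_algebra)

lemma space_info: "space \<mu> = X \<times> Y1 \<times> Y2"
  using sets_eq_imp_space_eq[OF sets_info] by (simp add: info_space_def space_pair_measure)

lemma cost_measurable[measurable]: "c \<in> borel_measurable (borel_sub X \<Otimes>\<^sub>M (borel_sub U1 \<Otimes>\<^sub>M borel_sub U2))"
  using game by (simp add: zero_sum_game_def)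

definition bound :: real where
  "bound = (SOME K. \<forall>x\<in>X. \<forall>u1\<in>U1. \<forall>u2\<in>U2. \<bar>c (x, u1, u2)\<bar> \<le> K)"

lemma cost_bound: "x \<in> X \<Longrightarrow> u1 \<in> U1 \<Longrightarrow> u2 \<in> U2 \<Longrightarrow> \<bar>c (x, u1, u2)\<bar> \<le> bound"
proof -
  obtain K where "\<forall>z\<in>X \<times> U1 \<times> U2. norm (c z) \<le> K"
    using game by (auto simp: zero_sum_game_def bounded_iff)
  then have "\<exists>K. \<forall>x\<in>X. \<forall>u1\<in>U1. \<forall>u2\<in>U2. \<bar>c (x, u1, u2)\<bar> \<le> K" by (intro exI[of _ K]) auto
  from someI_ex[OF this] show "x \<in> X \<Longrightarrow> u1 \<in> U1 \<Longrightarrow> u2 \<in> U2 \<Longrightarrow> \<bar>c (x, u1, u2)\<bar> \<le> bound"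
    unfolding bound_def by blast
qed

lemma action_sets_nonempty: "U1 \<noteq> {}" "U2 \<noteq> {}" and action_sets_borel: "U1 \<in> sets borel" "U2 \<in> sets borel"
  using game by (auto simp: zero_sum_game_def standard_borel_set_def)

lemma cost_slice_measurable: "x \<in> X \<Longrightarrow> (\<lambda>(u1, u2). c (x, u1, u2)) \<in> borel_measurable (borel_sub U1 \<Otimes>\<^sub>M borel_sub U2)"
  by measurable

text \<open>Both orders of Fubini are recorded: integrating out the opponent first leaves a bounded
  measurable test function of a player's own action, to which mixtures and limits of that player's
  policies apply.\<close>

lemma stage_cost_iterated:
  assumes x: "x \<in> X" and p: "p \<in> space (prob_algebra (borel_sub U1))" and q: "q \<in> space (prob_algebra (borel_sub U2))"
  shows "(\<integral>(u1, u2). c (x, u1, u2) \<partial>(p \<Otimes>\<^sub>M q)) = (\<integral>u1. (\<integral>u2. c (x, u1, u2) \<partial>q) \<partial>p)"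
    and "(\<integral>(u1, u2). c (x, u1, u2) \<partial>(p \<Otimes>\<^sub>M q)) = (\<integral>u2. (\<integral>u1. c (x, u1, u2) \<partial>p) \<partial>q)"
    and "(\<lambda>u1. \<integral>u2. c (x, u1, u2) \<partial>q) \<in> borel_measurable (borel_sub U1)"
    and "(\<lambda>u2. \<integral>u1. c (x, u1, u2) \<partial>p) \<in> borel_measurable (borel_sub U2)"
    and "\<And>u1. u1 \<in> U1 \<Longrightarrow> \<bar>\<integral>u2. c (x, u1, u2) \<partial>q\<bar> \<le> bound"
    and "\<And>u2. u2 \<in> U2 \<Longrightarrow> \<bar>\<integral>u1. c (x, u1, u2) \<partial>p\<bar> \<le> bound"
    and "\<bar>\<integral>(u1, u2). c (x, u1, u2) \<partial>(p \<Otimes>\<^sub>M q)\<bar> \<le> bound"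
proof -
  interpret p: prob_space p using p by (simp add: space_prob_algebra)
  interpret q: prob_space q using q by (simp add: space_prob_algebra)
  interpret pq: pair_prob_space p q ..
  have [measurable_cong]: "sets p = sets (borel_sub U1)" "sets q = sets (borel_sub U2)"
    using p q by (auto simp: space_prob_algebra)
  have sp: "space p = U1" "space q = U2" using prob_algebra_borel_subD(3)[OF p] prob_algebra_borel_subD(3)[OF q] by auto
  note m = cost_slice_measurable[OF x]
  have [measurable]: "(\<lambda>(u1, u2). c (x, u1, u2)) \<in> borel_measurable (p \<Otimes>\<^sub>M q)" using m by measurable
  have i: "integrable (p \<Otimes>\<^sub>M q) (\<lambda>(u1, u2). c (x, u1, u2))"
    using cost_bound[OF x] sp by (intro pq.P.integrable_const_bound[of _ bound]) (auto simp: space_pair_measure)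
  show "(\<integral>(u1, u2). c (x, u1, u2) \<partial>(p \<Otimes>\<^sub>M q)) = (\<integral>u1. (\<integral>u2. c (x, u1, u2) \<partial>q) \<partial>p)"
    using pq.integral_fst[OF i] by simp
  show "(\<integral>(u1, u2). c (x, u1, u2) \<partial>(p \<Otimes>\<^sub>M q)) = (\<integral>u2. (\<integral>u1. c (x, u1, u2) \<partial>p) \<partial>q)"
    using pq.integral_snd[OF i] by simp
  have "(\<lambda>u1. \<integral>u2. c (x, u1, u2) \<partial>q) \<in> borel_measurable p"
    by (rule q.borel_measurable_lebesgue_integral) measurable
  then show "(\<lambda>u1. \<integral>u2. c (x, u1, u2) \<partial>q) \<in> borel_measurable (borel_sub U1)" by measurable
  have "(\<lambda>u2. \<integral>u1. c (x, u1, u2) \<partial>p) \<in> borel_measurable q"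
    by (rule p.borel_measurable_lebesgue_integral) measurable
  then show "(\<lambda>u2. \<integral>u1. c (x, u1, u2) \<partial>p) \<in> borel_measurable (borel_sub U2)" by measurable
  have bd: "\<bar>\<integral>z. g z \<partial>M\<bar> \<le> bound" if "prob_space M" "\<And>z. z \<in> space M \<Longrightarrow> \<bar>g z\<bar> \<le> bound" for M and g :: "'z \<Rightarrow> real"
  proof -
    interpret M: prob_space M by fact
    have b0: "0 \<le> bound" using that(2) M.not_empty by (meson abs_ge_zero all_not_in_conv order_trans)
    have "\<bar>\<integral>z. g z \<partial>M\<bar> \<le> (\<integral>z. \<bar>g z\<bar> \<partial>M)" by (rule integral_abs_bound)
    also have "\<dots> \<le> (\<integral>z. bound \<partial>M)" using that(2) b0 by (intro integral_mono') auto
    finally show ?thesis by (simp add: M.prob_space)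
  qed
  show "\<bar>\<integral>u2. c (x, u1, u2) \<partial>q\<bar> \<le> bound" if "u1 \<in> U1" for u1
    using cost_bound[OF x that] sp by (intro bd q.prob_space_axioms) auto
  show "\<bar>\<integral>u1. c (x, u1, u2) \<partial>p\<bar> \<le> bound" if "u2 \<in> U2" for u2
    using cost_bound[OF x _ that] sp by (intro bd p.prob_space_axioms) auto
  show "\<bar>\<integral>(u1, u2). c (x, u1, u2) \<partial>(p \<Otimes>\<^sub>M q)\<bar> \<le> bound"
    using cost_bound[OF x] sp by (intro bd pq.P.prob_space_axioms) (auto simp: space_pair_measure)
qed

definition stage :: "('y1 \<Rightarrow> 'u1 measure) \<Rightarrow> ('y2 \<Rightarrow> 'u2 measure) \<Rightarrow> 'x \<times> 'y1 \<times> 'y2 \<Rightarrow> real" where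
  "stage \<gamma>1 \<gamma>2 = (\<lambda>(x, y1, y2). \<integral>(u1, u2). c (x, u1, u2) \<partial>(\<gamma>1 y1 \<Otimes>\<^sub>M \<gamma>2 y2))"

lemma expected_cost_stage: "expected_cost \<mu> c \<gamma>1 \<gamma>2 = (\<integral>z. stage \<gamma>1 \<gamma>2 z \<partial>\<mu>)"
  by (simp add: expected_cost_def stage_def)

context
  fixes \<gamma>1 \<gamma>2 assumes g: "\<gamma>1 \<in> policies Y1 U1" "\<gamma>2 \<in> policies Y2 U2"
begin

lemma stage_measurable: "stage \<gamma>1 \<gamma>2 \<in> borel_measurable \<mu>"
proof -
  have [measurable]: "\<gamma>1 \<in> borel_sub Y1 \<rightarrow>\<^sub>M subprob_algebra (borel_sub U1)" "\<gamma>2 \<in> borel_sub Y2 \<rightarrow>\<^sub>M subprob_algebra (borel_sub U2)"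
    using g by (auto simp: policies_def measurable_prob_algebraD)
  let ?I = "info_space X Y1 Y2"
  have [measurable]: "(\<lambda>z. fst (snd z)) \<in> ?I \<rightarrow>\<^sub>M borel_sub Y1" "(\<lambda>z. snd (snd z)) \<in> ?I \<rightarrow>\<^sub>M borel_sub Y2"
     "fst \<in> ?I \<rightarrow>\<^sub>M borel_sub X"
    unfolding info_space_def by measurable
  \<comment> \<open>Measurability is obtained one kernel at a time, with state and observations as
    parameters, and carried over to the product integral by Fubini at the end.\<close>
  have "(\<lambda>w. \<integral>u2. c (fst (fst w), snd w, u2) \<partial>\<gamma>2 (snd (snd (fst w)))) \<in> borel_measurable (?I \<Otimes>\<^sub>M borel_sub U1)"
    by (rule integral_measurable_subprob_algebra2[where N = "borel_sub U2"]) measurable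
  then have "(\<lambda>(z, u1). \<integral>u2. c (fst z, u1, u2) \<partial>\<gamma>2 (snd (snd z))) \<in> borel_measurable (?I \<Otimes>\<^sub>M borel_sub U1)"
    by (simp add: case_prod_beta)
  then have "(\<lambda>z. \<integral>u1. (\<integral>u2. c (fst z, u1, u2) \<partial>\<gamma>2 (snd (snd z))) \<partial>\<gamma>1 (fst (snd z))) \<in> borel_measurable ?I"
    by (rule integral_measurable_subprob_algebra2[where N = "borel_sub U1"]) measurable
  then have "(\<lambda>z. \<integral>u1. (\<integral>u2. c (fst z, u1, u2) \<partial>\<gamma>2 (snd (snd z))) \<partial>\<gamma>1 (fst (snd z))) \<in> borel_measurable \<mu>"
    by measurable
  then show ?thesis
    by (rule measurable_cong[THEN iffD1, rotated])
      (use stage_cost_iterated(1) policiesD(1)[OF g(1)] policiesD(1)[OF g(2)] in \<open>auto simp: space_info stage_def\<close>)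
qed

lemma stage_bound: "z \<in> space \<mu> \<Longrightarrow> \<bar>stage \<gamma>1 \<gamma>2 z\<bar> \<le> bound"
  using stage_cost_iterated(7) policiesD(1)[OF g(1)] policiesD(1)[OF g(2)] by (auto simp: space_info stage_def)

lemma stage_integrable: "integrable \<mu> (stage \<gamma>1 \<gamma>2)"
  using stage_measurable stage_bound by (intro integrable_const_bound[of _ bound]) auto

lemma expected_cost_bound: "\<bar>expected_cost \<mu> c \<gamma>1 \<gamma>2\<bar> \<le> bound"
proof -
  have "\<bar>expected_cost \<mu> c \<gamma>1 \<gamma>2\<bar> \<le> (\<integral>z. \<bar>stage \<gamma>1 \<gamma>2 z\<bar> \<partial>\<mu>)"
    unfolding expected_cost_stage by (rule integral_abs_bound)
  also have "\<dots> \<le> (\<integral>z. bound \<partial>\<mu>)"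
    using stage_integrable stage_bound by (intro integral_mono) auto
  finally show ?thesis by (simp add: prob_space)
qed

end

text \<open>Besides the cost, the action of \<open>m\<close> on test functions is returned, so that
  one mixture is affine in cost and in moments alike, as \<open>mixA\<close> demands.\<close>

lemma player1_mix:
  assumes \<gamma>: "\<gamma>1 \<in> policies Y1 U1" "\<gamma>1' \<in> policies Y1 U1" and t: "0 \<le> t" "t \<le> 1"
  shows "\<exists>m\<in>policies Y1 U1.
    (\<forall>\<gamma>2\<in>policies Y2 U2. expected_cost \<mu> c m \<gamma>2 = (1 - t) * expected_cost \<mu> c \<gamma>1 \<gamma>2 + t * expected_cost \<mu> c \<gamma>1' \<gamma>2) \<and>
    (\<forall>y\<in>Y1. \<forall>\<phi>::'u1 \<Rightarrow> real. \<forall>K. \<phi> \<in> borel_measurable (borel_sub U1) \<longrightarrow> (\<forall>u\<in>U1. \<bar>\<phi> u\<bar> \<le> K) \<longrightarrow>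
       (\<integral>u. \<phi> u \<partial>m y) = (1 - t) * (\<integral>u. \<phi> u \<partial>\<gamma>1 y) + t * (\<integral>u. \<phi> u \<partial>\<gamma>1' y))"
proof -
  obtain m where m: "m \<in> policies Y1 U1" and
    mix: "\<And>y \<phi> K. y \<in> Y1 \<Longrightarrow> (\<phi> :: 'u1 \<Rightarrow> real) \<in> borel_measurable (borel_sub U1) \<Longrightarrow> (\<forall>u\<in>U1. \<bar>\<phi> u\<bar> \<le> K) \<Longrightarrow>
       (\<integral>u. \<phi> u \<partial>m y) = (1 - t) * (\<integral>u. \<phi> u \<partial>\<gamma>1 y) + t * (\<integral>u. \<phi> u \<partial>\<gamma>1' y)"
    using policy_mix[OF \<gamma> t] by blast
  have "expected_cost \<mu> c m \<gamma>2 = (1 - t) * expected_cost \<mu> c \<gamma>1 \<gamma>2 + t * expected_cost \<mu> c \<gamma>1' \<gamma>2"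
    if \<gamma>2: "\<gamma>2 \<in> policies Y2 U2" for \<gamma>2
  proof -
    have "stage m \<gamma>2 z = (1 - t) * stage \<gamma>1 \<gamma>2 z + t * stage \<gamma>1' \<gamma>2 z" if "z \<in> space \<mu>" for z
    proof -
      obtain x y1 y2 where z: "z = (x, y1, y2)" "x \<in> X" "y1 \<in> Y1" "y2 \<in> Y2" using \<open>z \<in> space \<mu>\<close> by (auto simp: space_info)
      note q = policiesD(1)[OF \<gamma>2 z(4)]
      note it = stage_cost_iterated[OF z(2) _ q]
      show ?thesis
        unfolding z stage_def prod.case
        unfolding it(1)[OF policiesD(1)[OF m z(3)]] it(1)[OF policiesD(1)[OF \<gamma>(1) z(3)]] it(1)[OF policiesD(1)[OF \<gamma>(2) z(3)]]
        using it(3,5)[OF policiesD(1)[OF m z(3)]] z(3) by (intro mix[of _ _ bound]) auto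
    qed
    then have "expected_cost \<mu> c m \<gamma>2 = (\<integral>z. (1 - t) * stage \<gamma>1 \<gamma>2 z + t * stage \<gamma>1' \<gamma>2 z \<partial>\<mu>)"
      unfolding expected_cost_stage by (intro Bochner_Integration.integral_cong) auto
    then show ?thesis
      using stage_integrable[OF _ \<gamma>2] \<gamma> by (simp add: expected_cost_stage)
  qed
  then show ?thesis using m mix by blast
qed

lemma player2_mix:
  assumes \<gamma>: "\<gamma>2 \<in> policies Y2 U2" "\<gamma>2' \<in> policies Y2 U2" and t: "0 \<le> t" "t \<le> 1"
  shows "\<exists>m\<in>policies Y2 U2. \<forall>\<gamma>1\<in>policies Y1 U1.
    expected_cost \<mu> c \<gamma>1 m = (1 - t) * expected_cost \<mu> c \<gamma>1 \<gamma>2 + t * expected_cost \<mu> c \<gamma>1 \<gamma>2'"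
proof -
  obtain m where m: "m \<in> policies Y2 U2" and
    mix: "\<And>y \<phi> K. y \<in> Y2 \<Longrightarrow> (\<phi> :: 'u2 \<Rightarrow> real) \<in> borel_measurable (borel_sub U2) \<Longrightarrow> (\<forall>u\<in>U2. \<bar>\<phi> u\<bar> \<le> K) \<Longrightarrow>
       (\<integral>u. \<phi> u \<partial>m y) = (1 - t) * (\<integral>u. \<phi> u \<partial>\<gamma>2 y) + t * (\<integral>u. \<phi> u \<partial>\<gamma>2' y)"
    using policy_mix[OF \<gamma> t] by blast
  have "expected_cost \<mu> c \<gamma>1 m = (1 - t) * expected_cost \<mu> c \<gamma>1 \<gamma>2 + t * expected_cost \<mu> c \<gamma>1 \<gamma>2'"
    if \<gamma>1: "\<gamma>1 \<in> policies Y1 U1" for \<gamma>1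
  proof -
    have "stage \<gamma>1 m z = (1 - t) * stage \<gamma>1 \<gamma>2 z + t * stage \<gamma>1 \<gamma>2' z" if "z \<in> space \<mu>" for z
    proof -
      obtain x y1 y2 where z: "z = (x, y1, y2)" "x \<in> X" "y1 \<in> Y1" "y2 \<in> Y2" using \<open>z \<in> space \<mu>\<close> by (auto simp: space_info)
      note it = stage_cost_iterated[OF z(2) policiesD(1)[OF \<gamma>1 z(3)]]
      show ?thesis
        unfolding z stage_def prod.case
        unfolding it(2)[OF policiesD(1)[OF m z(4)]] it(2)[OF policiesD(1)[OF \<gamma>(1) z(4)]] it(2)[OF policiesD(1)[OF \<gamma>(2) z(4)]]
        using it(4,6)[OF policiesD(1)[OF m z(4)]] z(4) by (intro mix[of _ _ bound]) auto
    qed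
    then have "expected_cost \<mu> c \<gamma>1 m = (\<integral>z. (1 - t) * stage \<gamma>1 \<gamma>2 z + t * stage \<gamma>1 \<gamma>2' z \<partial>\<mu>)"
      unfolding expected_cost_stage by (intro Bochner_Integration.integral_cong) auto
    then show ?thesis
      using stage_integrable[OF \<gamma>1] \<gamma> by (simp add: expected_cost_stage)
  qed
  then show ?thesis using m by blast
qed

text \<open>Dominated convergence along sequences. This average is the test function for weak
  convergence of the player's own policies; the opponent's policy stays fixed, so no joint limit
  arises.\<close>

lemma continuous_on_average_cost:
  assumes cont: "\<And>u2. u2 \<in> U2 \<Longrightarrow> continuous_on U1 (\<lambda>u1. c (x, u1, u2))"
    and x: "x \<in> X" and q: "q \<in> space (prob_algebra (borel_sub U2))"
  shows "continuous_on U1 (\<lambda>u1. \<integral>u2. c (x, u1, u2) \<partial>q)"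
  unfolding continuous_on_sequentially
proof (intro allI ballI impI)
  fix u a assume u: "a \<in> U1" and "(\<forall>n. u n \<in> U1) \<and> u \<longlonglongrightarrow> a"
  then have un: "\<And>n. u n \<in> U1" and ua: "u \<longlonglongrightarrow> a" by auto
  interpret q: prob_space q using q by (simp add: space_prob_algebra)
  have sets_q: "sets q = sets (borel_sub U2)" using q by (auto simp: space_prob_algebra)
  have sp: "space q = U2" using prob_algebra_borel_subD(3)[OF q] by auto
  have meas: "(\<lambda>u2. c (x, v, u2)) \<in> borel_measurable q" if "v \<in> U1" for v
    using measurable_compose[OF measurable_Pair1'[of v "borel_sub U1" "borel_sub U2"] cost_slice_measurable[OF x]] that
    by (simp cong: measurable_cong_sets add: sets_q)
  have "(\<lambda>n. \<integral>u2. c (x, u n, u2) \<partial>q) \<longlonglongrightarrow> (\<integral>u2. c (x, a, u2) \<partial>q)"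
  proof (rule integral_dominated_convergence[where w = "\<lambda>_. bound"])
    show "AE u2 in q. (\<lambda>n. c (x, u n, u2)) \<longlonglongrightarrow> c (x, a, u2)"
    proof (rule AE_I2)
      fix u2 assume "u2 \<in> space q"
      then have "continuous_on U1 (\<lambda>u1. c (x, u1, u2))" using cont sp by auto
      then show "(\<lambda>n. c (x, u n, u2)) \<longlonglongrightarrow> c (x, a, u2)"
        using u un ua unfolding continuous_on_sequentially comp_def by blast
    qed
    show "AE u2 in q. norm (c (x, u n, u2)) \<le> bound" for n
      using cost_bound[OF x un] sp by auto
  qed (use meas u un in auto)
  then show "((\<lambda>u1. \<integral>u2. c (x, u1, u2) \<partial>q) \<circ> u) \<longlonglongrightarrow> (\<integral>u2. c (x, a, u2) \<partial>q)" by (simp add: comp_def)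
qed

lemma player1_minimax:
  assumes compact: "compact U1"
    and cont: "\<And>x u2. x \<in> X \<Longrightarrow> u2 \<in> U2 \<Longrightarrow> continuous_on U1 (\<lambda>u1. c (x, u1, u2))"
    and best: "\<And>\<gamma>2 \<epsilon>. \<gamma>2 \<in> policies Y2 U2 \<Longrightarrow> 0 < \<epsilon> \<Longrightarrow> \<exists>\<gamma>1\<in>policies Y1 U1. expected_cost \<mu> c \<gamma>1 \<gamma>2 \<le> w + \<epsilon>"
  shows "\<exists>\<gamma>1\<in>policies Y1 U1. \<forall>\<gamma>2\<in>policies Y2 U2. expected_cost \<mu> c \<gamma>1 \<gamma>2 \<le> w"
proof -
  obtain s where s: "moment_code U1 s" using moment_code_exists[OF compact] by blast
  have s_meas[measurable]: "s \<in> borel_measurable (borel_sub U1)"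
    using s unfolding moment_code_def borel_sub_def by (blast intro: measurable_restrict_space1)
  have s01: "0 \<le> s u" "s u \<le> 1" for u using s by (auto simp: moment_code_def)
  have sk: "\<bar>s u ^ k\<bar> \<le> 1" for u k using s01 by (simp add: power_le_one)
  have Y1m: "(\<lambda>z. fst (snd z)) \<in> \<mu> \<rightarrow>\<^sub>M borel_sub Y1"
    by (subst measurable_cong_sets[OF sets_info refl]) (simp add: info_space_def)
  \<comment> \<open>The law of player 1's observation under \<open>\<mu>\<close>:
    \<open>Q\<close>-null sets of observations pull back to \<open>\<mu>\<close>-null sets.\<close>
  define Q where "Q = distr \<mu> (borel_sub Y1) (\<lambda>z. fst (snd z))"
  interpret Q: prob_space Q unfolding Q_def using Y1m by (rule prob_space_distr)
  have setsQ[measurable_cong]: "sets Q = sets (borel_sub Y1)" and spaceQ: "space Q = Y1" by (simp_all add: Q_def)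
  \<comment> \<open>A geometric law charges every exponent, so an almost sure statement on the
    product yields, at almost every observation, convergence of all moments at once; being a
    probability law, it keeps the product a probability space.\<close>
  define P where "P = measure_pmf (geometric_pmf (1/2))"
  have setsP[measurable_cong]: "sets P = sets (count_space UNIV)" by (simp add: P_def)
  interpret P: prob_space P unfolding P_def by (rule prob_space_measure_pmf)
  interpret QP: pair_prob_space Q P ..
  define e where "e \<gamma> = (\<lambda>(y, k). \<integral>u. s u ^ k \<partial>\<gamma> y)" for \<gamma> :: "'y1 \<Rightarrow> 'u1 measure"
  show ?thesis
  proof (rule QP.P.one_sided_minimax[where e = e and K = bound])
    fix \<gamma> assume \<gamma>: "\<gamma> \<in> policies Y1 U1"
    have "(\<lambda>y. \<integral>u. s u ^ k \<partial>\<gamma> y) \<in> borel_measurable (borel_sub Y1)" for k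
      by (intro policy_integral_measurable[OF \<gamma>]) measurable
    from measurable_compose[OF measurable_fst this]
    have "(\<lambda>z. \<integral>u. s u ^ snd z \<partial>\<gamma> (fst z)) \<in> borel_measurable (borel_sub Y1 \<Otimes>\<^sub>M count_space (UNIV :: nat set))"
      by (rule measurable_compose_countable[where f = "\<lambda>k z. \<integral>u. s u ^ k \<partial>\<gamma> (fst z)" and g = snd, OF _ measurable_snd])
    then have "e \<gamma> \<in> borel_measurable (borel_sub Y1 \<Otimes>\<^sub>M count_space UNIV)"
      by (simp add: e_def case_prod_beta)
    then show "e \<gamma> \<in> borel_measurable (Q \<Otimes>\<^sub>M P)" by measurable
    fix z assume "z \<in> space (Q \<Otimes>\<^sub>M P)"
    then obtain y k where z: "z = (y, k)" "y \<in> Y1" by (auto simp: space_pair_measure spaceQ)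
    interpret \<gamma>: prob_space "\<gamma> y" by (rule policiesD[OF \<gamma> z(2)])
    have "\<bar>\<integral>u. s u ^ k \<partial>\<gamma> y\<bar> \<le> (\<integral>u. \<bar>s u ^ k\<bar> \<partial>\<gamma> y)" by (rule integral_abs_bound)
    also have "\<dots> \<le> (\<integral>u. 1 \<partial>\<gamma> y)" using sk by (intro integral_mono') auto
    finally show "\<bar>e \<gamma> z\<bar> \<le> 1" using z by (simp add: e_def \<gamma>.prob_space)
  next
    show "policies Y1 U1 \<noteq> {}" using policies_nonempty action_sets_nonempty by blast
    show "\<bar>expected_cost \<mu> c \<gamma>1 \<gamma>2\<bar> \<le> bound" if "\<gamma>1 \<in> policies Y1 U1" "\<gamma>2 \<in> policies Y2 U2" for \<gamma>1 \<gamma>2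
      using expected_cost_bound[OF that] .
  next
    fix \<gamma> \<gamma>' and t :: real assume *: "\<gamma> \<in> policies Y1 U1" "\<gamma>' \<in> policies Y1 U1" "0 \<le> t" "t \<le> 1"
    from player1_mix[OF *] obtain m where m: "m \<in> policies Y1 U1"
      "\<forall>\<gamma>2\<in>policies Y2 U2. expected_cost \<mu> c m \<gamma>2 = (1 - t) * expected_cost \<mu> c \<gamma> \<gamma>2 + t * expected_cost \<mu> c \<gamma>' \<gamma>2"
      "\<And>y \<phi> K. y \<in> Y1 \<Longrightarrow> (\<phi> :: 'u1 \<Rightarrow> real) \<in> borel_measurable (borel_sub U1) \<Longrightarrow> (\<forall>u\<in>U1. \<bar>\<phi> u\<bar> \<le> K) \<Longrightarrow>
       (\<integral>u. \<phi> u \<partial>m y) = (1 - t) * (\<integral>u. \<phi> u \<partial>\<gamma> y) + t * (\<integral>u. \<phi> u \<partial>\<gamma>' y)" by blast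
    have "e m z = (1 - t) * e \<gamma> z + t * e \<gamma>' z" if "z \<in> space (Q \<Otimes>\<^sub>M P)" for z
      using that m(3)[of "fst z" "\<lambda>u. s u ^ snd z" 1] sk
      by (auto simp: e_def space_pair_measure spaceQ)
    then show "\<exists>m\<in>policies Y1 U1.
        (\<forall>\<gamma>2\<in>policies Y2 U2. expected_cost \<mu> c m \<gamma>2 = (1 - t) * expected_cost \<mu> c \<gamma> \<gamma>2 + t * expected_cost \<mu> c \<gamma>' \<gamma>2) \<and>
        (\<forall>z\<in>space (Q \<Otimes>\<^sub>M P). e m z = (1 - t) * e \<gamma> z + t * e \<gamma>' z)"
      using m by blast
  next
    show "\<exists>m\<in>policies Y2 U2. \<forall>\<gamma>1\<in>policies Y1 U1.
        expected_cost \<mu> c \<gamma>1 m = (1 - t) * expected_cost \<mu> c \<gamma>1 \<gamma> + t * expected_cost \<mu> c \<gamma>1 \<gamma>'"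
      if "\<gamma> \<in> policies Y2 U2" "\<gamma>' \<in> policies Y2 U2" "0 \<le> t" "t \<le> 1" for \<gamma> \<gamma>' t
      using player2_mix[OF that] .
  next
    fix \<gamma> :: "nat \<Rightarrow> 'y1 \<Rightarrow> 'u1 measure"
    assume "range \<gamma> \<subseteq> policies Y1 U1" and conv: "AE z in Q \<Otimes>\<^sub>M P. convergent (\<lambda>n. e (\<gamma> n) z)"
    then have \<gamma>: "\<gamma> n \<in> policies Y1 U1" for n by auto
    obtain L where L: "L \<in> policies Y1 U1" and
      lim: "\<And>y \<phi>. y \<in> Y1 \<Longrightarrow> \<forall>k. convergent (\<lambda>n. \<integral>u. s u ^ k \<partial>\<gamma> n y) \<Longrightarrow>
        continuous_on U1 (\<phi> :: 'u1 \<Rightarrow> real) \<Longrightarrow> (\<lambda>n. \<integral>u. \<phi> u \<partial>\<gamma> n y) \<longlonglongrightarrow> (\<integral>u. \<phi> u \<partial>L y)"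
      using policy_limit[where \<gamma> = \<gamma>, OF s \<gamma> action_sets_nonempty(1) action_sets_borel(1)] by blast
    have "AE y in Q. AE k in P. convergent (\<lambda>n. e (\<gamma> n) (y, k))" using QP.AE_pair[OF conv] .
    then have "AE y in Q. \<forall>k. convergent (\<lambda>n. \<integral>u. s u ^ k \<partial>\<gamma> n y)"
      unfolding P_def AE_measure_pmf_iff by (simp add: set_pmf_geometric e_def)
    then have ae: "AE z in \<mu>. \<forall>k. convergent (\<lambda>n. \<integral>u. s u ^ k \<partial>\<gamma> n (fst (snd z)))"
      unfolding Q_def by (rule AE_distrD[OF Y1m])
    have "(\<lambda>n. expected_cost \<mu> c (\<gamma> n) \<gamma>2) \<longlonglongrightarrow> expected_cost \<mu> c L \<gamma>2" if \<gamma>2: "\<gamma>2 \<in> policies Y2 U2" for \<gamma>2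
      unfolding expected_cost_stage
    proof (rule integral_dominated_convergence[where w = "\<lambda>_. bound"])
      show "stage L \<gamma>2 \<in> borel_measurable \<mu>" "stage (\<gamma> n) \<gamma>2 \<in> borel_measurable \<mu>" for n
        using stage_measurable L \<gamma> \<gamma>2 by auto
      show "AE z in \<mu>. norm (stage (\<gamma> n) \<gamma>2 z) \<le> bound" for n
        using stage_bound[OF \<gamma> \<gamma>2] by auto
      show "AE z in \<mu>. (\<lambda>n. stage (\<gamma> n) \<gamma>2 z) \<longlonglongrightarrow> stage L \<gamma>2 z"
        using ae
      proof (rule AE_mp, intro AE_I2 impI)
        fix z assume "z \<in> space \<mu>" and cv: "\<forall>k. convergent (\<lambda>n. \<integral>u. s u ^ k \<partial>\<gamma> n (fst (snd z)))"
        then obtain x y1 y2 where z: "z = (x, y1, y2)" "x \<in> X" "y1 \<in> Y1" "y2 \<in> Y2" by (auto simp: space_info)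
        note q = policiesD(1)[OF \<gamma>2 z(4)]
        \<comment> \<open>State and opponent's observation are frozen; only the measure
          \<open>\<gamma> n y1\<close> varies, and it is tested against the averaged cost, which is
          continuous on \<open>U1\<close>.\<close>
        have "(\<lambda>n. \<integral>u1. (\<integral>u2. c (x, u1, u2) \<partial>\<gamma>2 y2) \<partial>\<gamma> n y1) \<longlonglongrightarrow> (\<integral>u1. (\<integral>u2. c (x, u1, u2) \<partial>\<gamma>2 y2) \<partial>L y1)"
          using cv z continuous_on_average_cost[OF cont _ q] by (intro lim) auto
        then show "(\<lambda>n. stage (\<gamma> n) \<gamma>2 z) \<longlonglongrightarrow> stage L \<gamma>2 z"
          unfolding z stage_def prod.case
          using stage_cost_iterated(1)[OF z(2) policiesD(1)[OF L z(3)] q]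
            stage_cost_iterated(1)[OF z(2) policiesD(1)[OF \<gamma> z(3)] q] by simp
      qed
    qed simp
    then show "\<exists>L\<in>policies Y1 U1. \<forall>\<gamma>2\<in>policies Y2 U2. (\<lambda>n. expected_cost \<mu> c (\<gamma> n) \<gamma>2) \<longlonglongrightarrow> expected_cost \<mu> c L \<gamma>2"
      using L by blast
  qed (use best in auto)
qed

end

section \<open>Exchange of the players\<close>

lemma zero_sum_game_swap:
  assumes "zero_sum_game X c U1 U2"
  shows "zero_sum_game X (\<lambda>(x, u2, u1). - c (x, u1, u2)) U2 U1"
proof -
  have [measurable]: "c \<in> borel_measurable (borel_sub X \<Otimes>\<^sub>M (borel_sub U1 \<Otimes>\<^sub>M borel_sub U2))"
    using assms by (simp add: zero_sum_game_def)
  have "(\<lambda>z. - c (fst z, snd (snd z), fst (snd z))) \<in> borel_measurable (borel_sub X \<Otimes>\<^sub>M (borel_sub U2 \<Otimes>\<^sub>M borel_sub U1))"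
    by measurable
  moreover have "bounded ((\<lambda>(x, u2, u1). - c (x, u1, u2)) ` (X \<times> U2 \<times> U1))"
    using assms by (fastforce simp: zero_sum_game_def bounded_iff)
  ultimately show ?thesis using assms by (simp add: zero_sum_game_def case_prod_beta)
qed

lemma swap_information_measurable:
  assumes "sets \<mu> = sets (info_space X Y1 Y2)"
  shows "(\<lambda>(x, y1, y2). (x, y2, y1)) \<in> \<mu> \<rightarrow>\<^sub>M info_space X Y2 Y1"
  by (subst measurable_cong_sets[OF assms refl]) (simp add: info_space_def)

lemma bounded_game_swap:
  assumes "bounded_game X Y1 Y2 U1 U2 c \<mu>"
  shows "bounded_game X Y2 Y1 U2 U1 (\<lambda>(x, u2, u1). - c (x, u1, u2))
    (distr \<mu> (info_space X Y2 Y1) (\<lambda>(x, y1, y2). (x, y2, y1)))"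
proof -
  interpret G: bounded_game X Y1 Y2 U1 U2 c \<mu> by fact
  show ?thesis
  proof
    show "distr \<mu> (info_space X Y2 Y1) (\<lambda>(x, y1, y2). (x, y2, y1)) \<in> space (prob_algebra (info_space X Y2 Y1))"
      using G.prob_space_distr[OF swap_information_measurable[OF G.sets_info]]
      by (simp add: space_prob_algebra)
    show "zero_sum_game X (\<lambda>(x, u2, u1). - c (x, u1, u2)) U2 U1"
      by (rule zero_sum_game_swap[OF G.game])
  qed
qed

text \<open>The exchange also reverses the factors of the product measure inside the stage cost, so
  besides the change of variables in \<open>\<mu>\<close> the two orders of Fubini have to be
  matched.\<close>

lemma expected_cost_swap:
  assumes "bounded_game X Y1 Y2 U1 U2 c \<mu>" and g: "\<gamma>1 \<in> policies Y1 U1" "\<gamma>2 \<in> policies Y2 U2"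
  shows "expected_cost (distr \<mu> (info_space X Y2 Y1) (\<lambda>(x, y1, y2). (x, y2, y1))) (\<lambda>(x, u2, u1). - c (x, u1, u2)) \<gamma>2 \<gamma>1
    = - expected_cost \<mu> c \<gamma>1 \<gamma>2"
proof -
  interpret G: bounded_game X Y1 Y2 U1 U2 c \<mu> by fact
  interpret S: bounded_game X Y2 Y1 U2 U1 "\<lambda>(x, u2, u1). - c (x, u1, u2)"
    "distr \<mu> (info_space X Y2 Y1) (\<lambda>(x, y1, y2). (x, y2, y1))"
    by (rule bounded_game_swap) fact
  have m: "S.stage \<gamma>2 \<gamma>1 \<in> borel_measurable (info_space X Y2 Y1)"
    using S.stage_measurable[OF g(2,1)] by simp
  have "S.stage \<gamma>2 \<gamma>1 (x, y2, y1) = - G.stage \<gamma>1 \<gamma>2 (x, y1, y2)" if "x \<in> X" "y1 \<in> Y1" "y2 \<in> Y2" for x y1 y2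
    using S.stage_cost_iterated(1)[OF that(1) policiesD(1)[OF g(2) that(3)] policiesD(1)[OF g(1) that(2)]]
      G.stage_cost_iterated(2)[OF that(1) policiesD(1)[OF g(1) that(2)] policiesD(1)[OF g(2) that(3)]]
    by (simp add: G.stage_def S.stage_def)
  then have "(\<integral>z. S.stage \<gamma>2 \<gamma>1 ((\<lambda>(x, y1, y2). (x, y2, y1)) z) \<partial>\<mu>) = (\<integral>z. - G.stage \<gamma>1 \<gamma>2 z \<partial>\<mu>)"
    by (intro Bochner_Integration.integral_cong) (auto simp: G.space_info)
  then show ?thesis
    unfolding S.expected_cost_stage G.expected_cost_stage
    using integral_distr[OF swap_information_measurable[OF G.sets_info] m] by simp
qed

lemma (in bounded_game) player2_minimax:
  assumes compact: "compact U2"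
    and cont: "\<And>x u1. x \<in> X \<Longrightarrow> u1 \<in> U1 \<Longrightarrow> continuous_on U2 (\<lambda>u2. c (x, u1, u2))"
    and best: "\<And>\<gamma>1 \<epsilon>. \<gamma>1 \<in> policies Y1 U1 \<Longrightarrow> 0 < \<epsilon> \<Longrightarrow> \<exists>\<gamma>2\<in>policies Y2 U2. w - \<epsilon> \<le> expected_cost \<mu> c \<gamma>1 \<gamma>2"
  shows "\<exists>\<gamma>2\<in>policies Y2 U2. \<forall>\<gamma>1\<in>policies Y1 U1. w \<le> expected_cost \<mu> c \<gamma>1 \<gamma>2"
proof -
  let ?c = "\<lambda>(x, u2, u1). - c (x, u1, u2)" and ?\<mu> = "distr \<mu> (info_space X Y2 Y1) (\<lambda>(x, y1, y2). (x, y2, y1))"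
  interpret S: bounded_game X Y2 Y1 U2 U1 ?c ?\<mu>
    by (rule bounded_game_swap) unfold_locales
  note swap = expected_cost_swap[OF bounded_game_axioms]
  have "\<exists>\<gamma>2\<in>policies Y2 U2. \<forall>\<gamma>1\<in>policies Y1 U1. expected_cost ?\<mu> ?c \<gamma>2 \<gamma>1 \<le> - w"
  proof (rule S.player1_minimax[OF compact])
    show "continuous_on U2 (\<lambda>u2. ?c (x, u2, u1))" if "x \<in> X" "u1 \<in> U1" for x u1
      using cont[OF that] by (simp add: continuous_on_minus)
    show "\<exists>\<gamma>2\<in>policies Y2 U2. expected_cost ?\<mu> ?c \<gamma>2 \<gamma>1 \<le> - w + \<epsilon>"
      if "\<gamma>1 \<in> policies Y1 U1" "0 < \<epsilon>" for \<gamma>1 \<epsilon>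
      using best[OF that] swap[OF that(1)] by force
  qed
  then show ?thesis using swap by force
qed

section \<open>Saddle point and value\<close>

lemma (in bounded_game) saddle_point:
  assumes "compact U1" "compact U2"
    and cont: "\<And>x. x \<in> X \<Longrightarrow> continuous_on (U1 \<times> U2) (\<lambda>(u1, u2). c (x, u1, u2))"
  shows "\<exists>\<gamma>1\<in>policies Y1 U1. \<exists>\<gamma>2\<in>policies Y2 U2.
    (\<forall>\<gamma>2'\<in>policies Y2 U2. expected_cost \<mu> c \<gamma>1 \<gamma>2' \<le> expected_cost \<mu> c \<gamma>1 \<gamma>2) \<and>
    (\<forall>\<gamma>1'\<in>policies Y1 U1. expected_cost \<mu> c \<gamma>1 \<gamma>2 \<le> expected_cost \<mu> c \<gamma>1' \<gamma>2)"
proof -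
  let ?A = "policies Y1 U1" and ?B = "policies Y2 U2" and ?V = "expected_cost \<mu> c"
  have ne: "?A \<noteq> {}" "?B \<noteq> {}" using policies_nonempty action_sets_nonempty by blast+
  have V: "?V \<gamma>1 \<gamma>2 \<le> bound" "- bound \<le> ?V \<gamma>1 \<gamma>2" if "\<gamma>1 \<in> ?A" "\<gamma>2 \<in> ?B" for \<gamma>1 \<gamma>2
    using expected_cost_bound[OF that] by auto
  have c1: "continuous_on U1 (\<lambda>u1. c (x, u1, u2))" if "x \<in> X" "u2 \<in> U2" for x u2
    using continuous_on_compose2[OF cont[OF that(1)], of U1 "\<lambda>u1. (u1, u2)"] that
    by (auto simp: continuous_on_Pair continuous_on_id continuous_on_const)
  have c2: "continuous_on U2 (\<lambda>u2. c (x, u1, u2))" if "x \<in> X" "u1 \<in> U1" for x u1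
    using continuous_on_compose2[OF cont[OF that(1)], of U2 "\<lambda>u2. (u1, u2)"] that
    by (auto simp: continuous_on_Pair continuous_on_id continuous_on_const)
  define lo where "lo \<gamma>2 = (INF \<gamma>1\<in>?A. ?V \<gamma>1 \<gamma>2)" for \<gamma>2
  \<comment> \<open>The lower value serves both players. Player 1 can answer each
    \<open>\<gamma>2\<close> within any slack, since \<open>lo \<gamma>2 \<le> w\<close>; for player
    2 a near-maximiser of \<open>lo\<close> does well against every \<open>\<gamma>1\<close>
    simultaneously. The two one-sided bounds then meet at cost exactly \<open>w\<close>.\<close>
  define w where "w = (SUP \<gamma>2\<in>?B. lo \<gamma>2)"
  have bb: "bdd_below ((\<lambda>\<gamma>1. ?V \<gamma>1 \<gamma>2) ` ?A)" if "\<gamma>2 \<in> ?B" for \<gamma>2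
    using V(2)[OF _ that] by (intro bdd_belowI[of _ "- bound"]) auto
  have lo_le: "lo \<gamma>2 \<le> ?V \<gamma>1 \<gamma>2" if "\<gamma>1 \<in> ?A" "\<gamma>2 \<in> ?B" for \<gamma>1 \<gamma>2
    unfolding lo_def by (rule cINF_lower[OF bb[OF that(2)] that(1)])
  have lo_bound: "lo \<gamma>2 \<le> bound" if "\<gamma>2 \<in> ?B" for \<gamma>2
    using lo_le[OF _ that] V(1)[OF _ that] ne(1) by (meson all_not_in_conv order_trans)
  have ba: "bdd_above (lo ` ?B)" using lo_bound by (intro bdd_aboveI[of _ bound]) auto
  obtain \<gamma>1 where \<gamma>1: "\<gamma>1 \<in> ?A" "\<And>\<gamma>2. \<gamma>2 \<in> ?B \<Longrightarrow> ?V \<gamma>1 \<gamma>2 \<le> w"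
  proof -
    have "\<exists>\<gamma>1\<in>?A. \<forall>\<gamma>2\<in>?B. ?V \<gamma>1 \<gamma>2 \<le> w"
    proof (rule player1_minimax[OF assms(1) c1])
      fix \<gamma>2 and \<epsilon> :: real assume *: "\<gamma>2 \<in> ?B" "0 < \<epsilon>"
      have "lo \<gamma>2 \<le> w" unfolding w_def by (rule cSUP_upper[OF *(1) ba])
      then have "lo \<gamma>2 < w + \<epsilon>" using * by simp
      then show "\<exists>\<gamma>1\<in>?A. ?V \<gamma>1 \<gamma>2 \<le> w + \<epsilon>"
        unfolding lo_def cINF_less_iff[OF ne(1) bb[OF *(1)]] by (auto intro: less_imp_le)
    qed
    then show ?thesis using that by blast
  qed
  obtain \<gamma>2 where \<gamma>2: "\<gamma>2 \<in> ?B" "\<And>\<gamma>1. \<gamma>1 \<in> ?A \<Longrightarrow> w \<le> ?V \<gamma>1 \<gamma>2"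
  proof -
    have "\<exists>\<gamma>2\<in>?B. \<forall>\<gamma>1\<in>?A. w \<le> ?V \<gamma>1 \<gamma>2"
    proof (rule player2_minimax[OF assms(2) c2])
      fix \<gamma> and \<epsilon> :: real assume \<gamma>: "\<gamma> \<in> ?A" "0 < \<epsilon>"
      obtain \<gamma>2 where "\<gamma>2 \<in> ?B" "w - \<epsilon> < lo \<gamma>2"
        using less_cSUP_iff[OF ne(2) ba, of "w - \<epsilon>"] \<gamma>(2) unfolding w_def by auto
      then show "\<exists>\<gamma>2\<in>?B. w - \<epsilon> \<le> ?V \<gamma> \<gamma>2"
        using lo_le[OF \<gamma>(1)] by (intro bexI[of _ \<gamma>2]) (auto intro: order_trans less_imp_le)
    qed
    then show ?thesis using that by blast
  qed
  have "?V \<gamma>1 \<gamma>2 = w" using \<gamma>1 \<gamma>2 by (simp add: antisym)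
  then show ?thesis using \<gamma>1 \<gamma>2 by auto
qed

text \<open>The outer infimum is attained at \<open>a\<close> and the outer supremum at
  \<open>b\<close>. The bound \<open>K\<close> enters because real infima and suprema obey their
  defining inequalities only on bounded sets.\<close>

lemma saddle_point_imp_inf_sup_eq:
  fixes V :: "'a \<Rightarrow> 'b \<Rightarrow> real"
  assumes a: "a \<in> A" and b: "b \<in> B"
    and hi: "\<And>y. y \<in> B \<Longrightarrow> V a y \<le> V a b" and lo: "\<And>x. x \<in> A \<Longrightarrow> V a b \<le> V x b"
    and bnd: "\<And>x y. x \<in> A \<Longrightarrow> y \<in> B \<Longrightarrow> \<bar>V x y\<bar> \<le> K"
  shows "(INF x\<in>A. V x b) = V a b" "V a b = (SUP y\<in>B. V a y)"
    "(INF x\<in>A. SUP y\<in>B. V x y) = V a b" "(SUP y\<in>B. INF x\<in>A. V x y) = V a b"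
proof -
  have B: "V x y \<le> K" "- K \<le> V x y" if "x \<in> A" "y \<in> B" for x y using bnd[OF that] by auto
  have ba: "bdd_above (V x ` B)" if "x \<in> A" for x using B[OF that] by (intro bdd_aboveI[of _ K]) auto
  have bb: "bdd_below ((\<lambda>x. V x y) ` A)" if "y \<in> B" for y using B[OF _ that] by (intro bdd_belowI[of _ "- K"]) auto
  show inf: "(INF x\<in>A. V x b) = V a b"
    using a lo by (intro cInf_eq_minimum) auto
  show sup: "V a b = (SUP y\<in>B. V a y)"
    using b hi by (intro cSup_eq_maximum[symmetric]) auto
  have up: "V a b \<le> (SUP y\<in>B. V x y)" if "x \<in> A" for x
    using lo[OF that] cSUP_upper[OF b ba[OF that]] by linarith
  show "(INF x\<in>A. SUP y\<in>B. V x y) = V a b"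
    using a up by (intro cInf_eq_minimum) (auto simp: image_iff sup[symmetric] intro!: bexI[of _ a])
  have dn: "(INF x\<in>A. V x y) \<le> V a b" if "y \<in> B" for y
    using hi[OF that] cINF_lower[OF bb[OF that] a] by linarith
  show "(SUP y\<in>B. INF x\<in>A. V x y) = V a b"
    using b dn by (intro cSup_eq_maximum) (auto simp: image_iff inf intro!: bexI[of _ b])
qed

theorem theorem3p1:
  fixes X :: "'x::polish_space set"
    and Y1 :: "'y1::polish_space set"
    and Y2 :: "'y2::polish_space set"
    and U1 :: "'u1::polish_space set"
    and U2 :: "'u2::polish_space set"
    and \<zeta> :: "'x measure"
    and \<mu> :: "('x \<times> 'y1 \<times> 'y2) measure"
    and c :: "'x \<times> 'u1 \<times> 'u2 \<Rightarrow> real"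
    and Q1 :: "'y1 measure"
    and Q2 :: "'y2 measure"
    and f :: "'x \<times> 'y1 \<times> 'y2 \<Rightarrow> real"
  assumes "standard_borel_set X" and "standard_borel_set Y1" and "standard_borel_set Y2"
    and "\<zeta> \<in> space (prob_algebra (borel_sub X))"
    and "information_structure X Y1 Y2 \<zeta> \<mu>"
    and "zero_sum_game X c U1 U2"
    and "Q1 \<in> space (prob_algebra (borel_sub Y1))"
    and "Q2 \<in> space (prob_algebra (borel_sub Y2))"
    and "integrable (\<zeta> \<Otimes>\<^sub>M (Q1 \<Otimes>\<^sub>M Q2)) f"
    and "\<And>A B C. A \<in> sets (borel_sub X) \<Longrightarrow> B \<in> sets (borel_sub Y1) \<Longrightarrow> C \<in> sets (borel_sub Y2) \<Longrightarrow>
           measure \<mu> (A \<times> B \<times> C) = (LINT z : A \<times> B \<times> C | \<zeta> \<Otimes>\<^sub>M (Q1 \<Otimes>\<^sub>M Q2). f z)"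
    and "compact U1" and "compact U2"
    and "\<And>x. x \<in> X \<Longrightarrow> continuous_on (U1 \<times> U2) (\<lambda>(u1, u2). c (x, u1, u2))"
  shows "(\<exists>\<gamma>1 \<gamma>2. equilibrium Y1 Y2 \<mu> c U1 U2 \<gamma>1 \<gamma>2) \<and> has_value Y1 Y2 \<mu> c U1 U2"
proof -
  interpret bounded_game X Y1 Y2 U1 U2 c \<mu>
    using assms(5,6) by unfold_locales (auto simp: information_structure_def)
  obtain \<gamma>1 \<gamma>2 where \<gamma>: "\<gamma>1 \<in> policies Y1 U1" "\<gamma>2 \<in> policies Y2 U2"
    and sp: "\<And>\<gamma>. \<gamma> \<in> policies Y2 U2 \<Longrightarrow> expected_cost \<mu> c \<gamma>1 \<gamma> \<le> expected_cost \<mu> c \<gamma>1 \<gamma>2"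
      "\<And>\<gamma>. \<gamma> \<in> policies Y1 U1 \<Longrightarrow> expected_cost \<mu> c \<gamma>1 \<gamma>2 \<le> expected_cost \<mu> c \<gamma> \<gamma>2"
    using saddle_point[OF assms(11-13)] by blast
  have *: "(INF \<gamma>\<in>policies Y1 U1. expected_cost \<mu> c \<gamma> \<gamma>2) = expected_cost \<mu> c \<gamma>1 \<gamma>2"
    "expected_cost \<mu> c \<gamma>1 \<gamma>2 = (SUP \<gamma>\<in>policies Y2 U2. expected_cost \<mu> c \<gamma>1 \<gamma>)"
    "(INF \<gamma>1\<in>policies Y1 U1. SUP \<gamma>2\<in>policies Y2 U2. expected_cost \<mu> c \<gamma>1 \<gamma>2) = expected_cost \<mu> c \<gamma>1 \<gamma>2"
    "(SUP \<gamma>2\<in>policies Y2 U2. INF \<gamma>1\<in>policies Y1 U1. expected_cost \<mu> c \<gamma>1 \<gamma>2) = expected_cost \<mu> c \<gamma>1 \<gamma>2"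
    using saddle_point_imp_inf_sup_eq[where V = "expected_cost \<mu> c", OF \<gamma> sp expected_cost_bound] by blast+
  then have "equilibrium Y1 Y2 \<mu> c U1 U2 \<gamma>1 \<gamma>2" using \<gamma> by (simp add: equilibrium_def)
  moreover have "has_value Y1 Y2 \<mu> c U1 U2" unfolding has_value_def using *(3,4) by simp
  ultimately show ?thesis by blast
qed

end
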